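(* Let $n\ge1$, $s\in(0,1)$, $p>1$, $\Lambda\ge1$, $F_0\ge0$, and let $\Omega\subset\mathbb{R}^n$ be a bounded open set. Let $K:\mathbb{R}^n\times\mathbb{R}^n\to\mathbb{R}$ be a non-negative measurable function with $K(x,y)=K(y,x)$ and $$\frac{1}{\Lambda|x-y|^{n+sp}}\le K(x,y)\le\frac{\Lambda}{|x-y|^{n+sp}}\qquad\text{for a.e. }x,y\in\mathbb{R}^n,$$ and let $F:\Omega\times\mathbb{R}\to\mathbb{R}$ be a Carath\'eodory function with $|F(x,t)|\le F_0$ for a.e. $x\in\Omega$ and every $t\in\mathbb{R}$. For measurable $u:\mathbb{R}^n\to\mathbb{R}$ set $$\mathcal{E}(u;\Omega)=\frac1{2p}\iint_{\mathcal{C}_\Omega}|u(x)-u(y)|^pK(x,y)\,dx\,dy+\int_\Omega F(x,u(x))\,dx,\qquad \mathcal{C}_\Omega=\mathbb{R}^{2n}\setminus(\mathbb{R}^n\setminus\Omega)^2.$$ Let $u\in L^{p-1}_s(\mathbb{R}^n)\cap\mathbb{W}^{s,p}(\Omega)$. There exists a constant $H\ge1$, depending only on $n$, $s$, $p$, and $\Lambda$, such that: (a) if $u$ is a superminimizer of $\mathcal{E}$ in $\Omega$, then $u\in\mathrm{DG}^{s,p}_-(\Omega;F_0^{1/p},H,0)$; (b) if $u$ is a subminimizer of $\mathcal{E}$ in $\Omega$, then $u\in\mathrm{DG}^{s,p}_+(\Omega;F_0^{1/p},H,0)$; (c) if $u$ is a minimizer of $\mathcal{E}$ in $\Omega$,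 then $u\in\mathrm{DG}^{s,p}(\Omega;F_0^{1/p},H,0)$.
   Context: Notation. $B_R(x_0)$ is the open ball of radius $R$ centered at $x_0$ in $\mathbb{R}^n$; $|E|$ is Lebesgue measure; $v_+=\max\{v,0\}$, $v_-=\max\{-v,0\}$. For an open set $U$, $[u]_{W^{s,p}(U)}^p=\int_U\int_U\frac{|u(x)-u(y)|^p}{|x-y|^{n+sp}}\,dx\,dy$, and $W^{s,p}(U)$ is the space of $u\in L^p(U)$ with $[u]_{W^{s,p}(U)}<\infty$. $L^{p-1}_s(\mathbb{R}^n)$ is the set of measurable $u:\mathbb{R}^n\to\mathbb{R}$ with $\int_{\mathbb{R}^n}\frac{|u(x)|^{p-1}}{(1+|x|)^{n+sp}}\,dx<\infty$. $\mathbb{W}^{s,p}(\Omega)$ is the set of $u:\mathbb{R}^n\to\mathbb{R}$ with $u|_\Omega\in L^p(\Omega)$ and $\iint_{\mathcal{C}_\Omega}\frac{|u(x)-u(y)|^p}{|x-y|^{n+sp}}\,dx\,dy<\infty$. Minimizers. A function $u\in\mathbb{W}^{s,p}(\Omega)$ is a superminimizer (resp. subminimizer, resp. minimizer) of $\mathcal{E}$ in $\Omega$ if $\mathcal{E}(u;\Omega)\le\mathcal{E}(u+\varphi;\Omega)$ for every non-negative (resp. non-positive, resp. arbitrary) measurable function $\varphi:\mathbb{R}^n\to\mathbb{R}$ supported inside $\Omega$. For $v\in L^{p-1}_s(\mathbb{R}^n)$, $$\overline{\mathrm{Tail}}_{s,p}(v;x_0,R)=\left(\int_{\mathbb{R}^n\setminus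 B_R(x_0)}\frac{|v(x)|^{p-1}}{|x-x_0|^{n+sp}}\,dx\right)^{\frac1{p-1}}.$$ For $k\in\mathbb{R}$, $A^+(k,x_0,R)=\{u>k\}\cap B_R(x_0)$ and $A^-(k,x_0,R)=\{u<k\}\cap B_R(x_0)$. Fractional De Giorgi class. Let $d,\lambda\ge0$, $H\ge1$. A function $u\in L^{p-1}_s(\mathbb{R}^n)$ with $u|_\Omega\in W^{s,p}(\Omega)$ belongs to $\mathrm{DG}^{s,p}_\pm(\Omega;d,H,\lambda)$ (one fixed choice of upper or lower signs throughout) if $$[(u-k)_\pm]_{W^{s,p}(B_r(x_0))}^p+\int_{B_r(x_0)}(u(x)-k)_\pm\left\{\int_{\mathbb{R}^n}\frac{(u(y)-k)_\mp^{p-1}}{|x-y|^{n+sp}}\,dy\right\}dx$$ $$\le H\Big\{R^\lambda d^p|A^\pm(k,x_0,R)|+\frac{R^{(1-s)p}}{(R-r)^p}\|(u-k)_\pm\|_{L^p(B_R(x_0))}^p+\frac{R^{n+sp}}{(R-r)^{n+sp}}\|(u-k)_\pm\|_{L^1(B_R(x_0))}\,\overline{\mathrm{Tail}}_{s,p}((u-k)_\pm;x_0,r)^{p-1}\Big\}$$ for every $x_0\in\Omega$, $0<r<R<\mathrm{dist}(x_0,\partial\Omega)$, and $k\in\mathbb{R}$. Moreover $\mathrm{DG}^{s,p}(\Omega;d,H,\lambda)=\mathrm{DG}^{s,p}_+(\Omega;d,H,\lambda)\cap\mathrm{DG}^{s,p}_-(\Omega;d,H,\lambda)$. *)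

theory Defs
  imports "HOL-Analysis.Analysis"
begin

text \<open>
  The ambient space is \<open>real ^ 'n\<close>, so the dimension is \<open>CARD('n) \<ge> 1\<close>. ``Measurable'' and
  ``a.e.'' refer to Lebesgue measure, i.e. to the completed measure \<open>lebesgue\<close> (also on the product
  space). Integrals of non-negative functions that may be infinite are taken in \<open>[0, \<infinity>]\<close>.
  In all kernels the quotient is \<open>0\<close> on the diagonal, which is a null set.
\<close>

definition in_Lp :: "real \<Rightarrow> (real ^ 'n) set \<Rightarrow> (real ^ 'n \<Rightarrow> real) \<Rightarrow> bool" where
  "in_Lp p U u \<longleftrightarrow> u \<in> borel_measurable (lebesgue_on U)
     \<and> integrable (lebesgue_on U) (\<lambda>x. \<bar>u x\<bar> powr p)"

definition Lp_norm :: "real \<Rightarrow> (real ^ 'n) set \<Rightarrow> (real ^ 'n \<Rightarrow> real) \<Rightarrow> real" where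
  "Lp_norm p U u = (\<integral>x. \<bar>u x\<bar> powr p \<partial>lebesgue_on U) powr (1 / p)"

text \<open>The \<open>p\<close>-th power of the Gagliardo seminorm.\<close>

definition gagliardo_pow ::
    "real \<Rightarrow> real \<Rightarrow> (real ^ 'n) set \<Rightarrow> (real ^ 'n \<Rightarrow> real) \<Rightarrow> ennreal" where
  "gagliardo_pow s p U u =
     (\<integral>\<^sup>+y. (\<integral>\<^sup>+x. ennreal (\<bar>u x - u y\<bar> powr p / norm (x - y) powr (real CARD('n) + s * p))
        \<partial>lebesgue_on U) \<partial>lebesgue_on U)"

definition frac_sobolev :: "real \<Rightarrow> real \<Rightarrow> (real ^ 'n) set \<Rightarrow> (real ^ 'n \<Rightarrow> real) set" where
  "frac_sobolev s p U = {u. in_Lp p U u \<and> gagliardo_pow s p U u < \<infinity>}"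

text \<open>The space \<open>L\<^sup>p\<^sup>-\<^sup>1\<^sub>s(\<real>\<^sup>n)\<close>.\<close>

definition tail_space :: "real \<Rightarrow> real \<Rightarrow> (real ^ 'n \<Rightarrow> real) set" where
  "tail_space s p = {u. u \<in> borel_measurable lebesgue \<and>
     (\<integral>\<^sup>+x. ennreal (\<bar>u x\<bar> powr (p - 1) / (1 + norm x) powr (real CARD('n) + s * p)) \<partial>lebesgue)
       < \<infinity>}"

definition C_dom :: "(real ^ 'n) set \<Rightarrow> ((real ^ 'n) \<times> (real ^ 'n)) set" where
  "C_dom \<Omega> = - ((- \<Omega>) \<times> (- \<Omega>))"

text \<open>The space \<open>\<bbbW>\<^sup>s\<^sup>,\<^sup>p(\<Omega>)\<close>.\<close>

definition energy_space :: "real \<Rightarrow> real \<Rightarrow> (real ^ 'n) set \<Rightarrow> (real ^ 'n \<Rightarrow> real) set" where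
  "energy_space s p \<Omega> = {u. u \<in> borel_measurable lebesgue \<and> in_Lp p \<Omega> u \<and>
     (\<integral>\<^sup>+(x, y). ennreal (\<bar>u x - u y\<bar> powr p / norm (x - y) powr (real CARD('n) + s * p))
        \<partial>lebesgue_on (C_dom \<Omega>)) < \<infinity>}"

text \<open>
  The double integral may be \<open>\<infinity>\<close>; the potential term is an ordinary Lebesgue integral, finite for
  a bounded Caratheodory function \<open>F\<close> on a bounded set \<open>\<Omega>\<close>.
\<close>

definition energy ::
    "real \<Rightarrow> (real ^ 'n \<Rightarrow> real ^ 'n \<Rightarrow> real) \<Rightarrow> (real ^ 'n \<Rightarrow> real \<Rightarrow> real) \<Rightarrow>
     (real ^ 'n) set \<Rightarrow> (real ^ 'n \<Rightarrow> real) \<Rightarrow> ereal" where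
  "energy p K F \<Omega> u =
     ereal (1 / (2 * p)) *
       enn2ereal (\<integral>\<^sup>+(x, y). ennreal (\<bar>u x - u y\<bar> powr p * K x y) \<partial>lebesgue_on (C_dom \<Omega>))
     + ereal (\<integral>x. F x (u x) \<partial>lebesgue_on \<Omega>)"

definition supported_inside :: "(real ^ 'n \<Rightarrow> real) \<Rightarrow> (real ^ 'n) set \<Rightarrow> bool" where
  "supported_inside \<phi> \<Omega> \<longleftrightarrow> closure {x. \<phi> x \<noteq> 0} \<subseteq> \<Omega>"

definition minimizer where
  "minimizer s p K F \<Omega> u \<longleftrightarrow> u \<in> energy_space s p \<Omega> \<and>
     (\<forall>\<phi>. \<phi> \<in> borel_measurable lebesgue \<and> supported_inside \<phi> \<Omega>
        \<longrightarrow> energy p K F \<Omega> u \<le> energy p K F \<Omega> (\<lambda>x. u x + \<phi> x))"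

definition superminimizer where
  "superminimizer s p K F \<Omega> u \<longleftrightarrow> u \<in> energy_space s p \<Omega> \<and>
     (\<forall>\<phi>. \<phi> \<in> borel_measurable lebesgue \<and> supported_inside \<phi> \<Omega> \<and> (\<forall>x. 0 \<le> \<phi> x)
        \<longrightarrow> energy p K F \<Omega> u \<le> energy p K F \<Omega> (\<lambda>x. u x + \<phi> x))"

definition subminimizer where
  "subminimizer s p K F \<Omega> u \<longleftrightarrow> u \<in> energy_space s p \<Omega> \<and>
     (\<forall>\<phi>. \<phi> \<in> borel_measurable lebesgue \<and> supported_inside \<phi> \<Omega> \<and> (\<forall>x. \<phi> x \<le> 0)
        \<longrightarrow> energy p K F \<Omega> u \<le> energy p K F \<Omega> (\<lambda>x. u x + \<phi> x))"

definition caratheodory_on :: "(real ^ 'n) set \<Rightarrow> (real ^ 'n \<Rightarrow> real \<Rightarrow> real) \<Rightarrow> bool" where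
  "caratheodory_on \<Omega> F \<longleftrightarrow>
     (\<forall>t. (\<lambda>x. F x t) \<in> borel_measurable (lebesgue_on \<Omega>)) \<and>
     (AE x in lebesgue_on \<Omega>. continuous_on UNIV (F x))"

text \<open>The integral is finite for \<open>v \<in> tail_space s p\<close> and \<open>R > 0\<close>.\<close>

definition Tail ::
    "real \<Rightarrow> real \<Rightarrow> (real ^ 'n \<Rightarrow> real) \<Rightarrow> real ^ 'n \<Rightarrow> real \<Rightarrow> real" where
  "Tail s p v x\<^sub>0 R =
     (\<integral>x. \<bar>v x\<bar> powr (p - 1) / norm (x - x\<^sub>0) powr (real CARD('n) + s * p)
        \<partial>lebesgue_on (- ball x\<^sub>0 R)) powr (1 / (p - 1))"

text \<open>Upper and lower signs are selected by a parameter of type \<open>sgn2\<close>.\<close>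

datatype sgn2 = Plus | Minus

fun flip :: "sgn2 \<Rightarrow> sgn2" where
  "flip Plus = Minus"
| "flip Minus = Plus"

fun part :: "sgn2 \<Rightarrow> real \<Rightarrow> real" where
  "part Plus v = max v 0"
| "part Minus v = max (- v) 0"

fun level_set ::
    "sgn2 \<Rightarrow> (real ^ 'n \<Rightarrow> real) \<Rightarrow> real \<Rightarrow> real ^ 'n \<Rightarrow> real \<Rightarrow> (real ^ 'n) set" where
  "level_set Plus u k x\<^sub>0 R = {x. u x > k} \<inter> ball x\<^sub>0 R"
| "level_set Minus u k x\<^sub>0 R = {x. u x < k} \<inter> ball x\<^sub>0 R"

text \<open>
  The left-hand side lives in \<open>[0, \<infinity>]\<close>; for \<open>u\<close> in the two spaces required below, the measure, norms
  and tail on the right-hand side are finite, so it is a real number. For bounded nonempty \<open>\<Omega>\<close> the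
  frontier is nonempty and \<open>infdist\<close> is the usual distance.
\<close>

definition DG_signed ::
    "sgn2 \<Rightarrow> real \<Rightarrow> real \<Rightarrow> (real ^ 'n) set \<Rightarrow> real \<Rightarrow> real \<Rightarrow> real \<Rightarrow> (real ^ 'n \<Rightarrow> real) set" where
  "DG_signed \<sigma> s p \<Omega> d H l = {u. u \<in> tail_space s p \<and> u \<in> frac_sobolev s p \<Omega> \<and>
     (\<forall>x\<^sub>0 r R k. x\<^sub>0 \<in> \<Omega> \<and> 0 < r \<and> r < R \<and> R < infdist x\<^sub>0 (frontier \<Omega>) \<longrightarrow>
        gagliardo_pow s p (ball x\<^sub>0 r) (\<lambda>x. part \<sigma> (u x - k))
        + (\<integral>\<^sup>+x. ennreal (part \<sigma> (u x - k)) *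
             (\<integral>\<^sup>+y. ennreal (part (flip \<sigma>) (u y - k) powr (p - 1)
                / norm (x - y) powr (real CARD('n) + s * p)) \<partial>lebesgue) \<partial>lebesgue_on (ball x\<^sub>0 r))
        \<le> ennreal (H *
            (R powr l * d powr p * measure lebesgue (level_set \<sigma> u k x\<^sub>0 R)
             + R powr ((1 - s) * p) / (R - r) powr p
                 * Lp_norm p (ball x\<^sub>0 R) (\<lambda>x. part \<sigma> (u x - k)) powr p
             + R powr (real CARD('n) + s * p) / (R - r) powr (real CARD('n) + s * p)
                 * Lp_norm 1 (ball x\<^sub>0 R) (\<lambda>x. part \<sigma> (u x - k))
                 * Tail s p (\<lambda>x. part \<sigma> (u x - k)) x\<^sub>0 r powr (p - 1))))}"

abbreviation "DG_plus \<equiv> DG_signed Plus"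
abbreviation "DG_minus \<equiv> DG_signed Minus"

definition DG ::
    "real \<Rightarrow> real \<Rightarrow> (real ^ 'n) set \<Rightarrow> real \<Rightarrow> real \<Rightarrow> real \<Rightarrow> (real ^ 'n \<Rightarrow> real) set" where
  "DG s p \<Omega> d H l = DG_plus s p \<Omega> d H l \<inter> DG_minus s p \<Omega> d H l"

end

theory Submission
  imports Defs
begin

text \<open>
  Let \<open>\<sigma>\<close> be a sign, \<open>w = (u - k)\<^sub>\<sigma>\<close> the part of \<open>u - k\<close> to be estimated, \<open>m\<close> the part of the opposite
  sign, and \<open>e\<close> a Lipschitz cutoff that is \<open>1\<close> on the ball of radius \<open>r\<close> and \<open>0\<close> off the ball of radius
  \<open>(R + r) / 2\<close>. The competitor \<open>v\<close> is obtained from \<open>u\<close> by replacing \<open>w\<close> with \<open>(1 - e\<^sup>p) w\<close>. It lies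
  below \<open>u\<close> for the upper sign and above \<open>u\<close> for the lower sign, so it is admissible for a subminimizer
  and for a superminimizer respectively, and both signs run through the same computation.

  The heart of the matter is pointwise: for all \<open>x\<close>, \<open>y\<close>,
  \<open>\<bar>v x - v y\<bar>\<^sup>p + gain \<le> \<bar>u x - u y\<bar>\<^sup>p + error\<close> (lemma \<open>truncation_pointwise\<close>). The exponent \<open>p\<close> on the
  cutoff is what makes this a direct consequence of the convexity of \<open>t\<^sup>p\<close>: if \<open>x\<close> and \<open>y\<close> both lie
  where \<open>w\<close> is positive and \<open>e y \<le> e x\<close>, then with \<open>\<theta> = e\<^sup>p x\<close> the difference \<open>v x - v y\<close> is the convex
  combination of \<open>w x - w y\<close> with weight \<open>1 - \<theta>\<close> and of \<open>-(\<theta> - e\<^sup>p y) w y / \<theta>\<close> with weight \<open>\<theta>\<close>. The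
  \<open>p\<close>-th power of the second term times \<open>\<theta>\<close> is at most \<open>p\<^sup>p \<bar>e x - e y\<bar>\<^sup>p (w y)\<^sup>p\<close>, because
  \<open>\<theta> - e\<^sup>p y \<le> p (e x) powr (p - 1) (e x - e y)\<close>. The first term leaves the fraction \<open>\<theta>\<close> of
  \<open>\<bar>w x - w y\<bar>\<^sup>p\<close> to spare, and on the ball of radius \<open>r\<close> this is the whole of it. If only
  \<open>x\<close> lies where \<open>w\<close> is positive, then \<open>u x - u y\<close> has size \<open>w x + m y\<close>, and shrinking \<open>w x\<close> gains both
  \<open>(w x)\<^sup>p\<close> and the mixed term \<open>w x * (m y) powr (p - 1)\<close>. If \<open>y\<close> lies outside the ball of radius
  \<open>R\<close>, the first estimate is useless since \<open>w\<^sup>p\<close> need not be integrable there; instead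
  \<open>\<bar>v x - v y\<bar>\<^sup>p - \<bar>u x - u y\<bar>\<^sup>p\<close> is at most \<open>p * w x * (w y) powr (p - 1)\<close>.

  The pointwise inequality is multiplied by \<open>K\<close> and integrated, and the finite nonlocal energy of
  \<open>u\<close> is cancelled. Minimality bounds the energy of \<open>u\<close> by that of \<open>v\<close> up
  to the change of the potential, which is at most \<open>2 F\<^sub>0\<close> times the measure of the level
  set, since \<open>u\<close> and \<open>v\<close> agree elsewhere. The integral of the gain against \<open>1 /
  \<bar>x - y\<bar> powr (n + s p)\<close> is half of the left-hand side of the De Giorgi inequality
  (\<open>nn_integral_local_gain\<close>). The near error is controlled by \<open>\<bar>e x - e y\<bar> \<le> 2
  \<bar>x - y\<bar> / (R - r)\<close> and the integrability of \<open>\<bar>x - y\<bar> powr ((1 - s) p -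
  n)\<close> over balls, which gives the \<open>L\<^sup>p\<close> term; the far error is controlled by
  \<open>\<bar>x - y\<bar> \<ge> \<bar>y - c\<bar> (R - r) / (2 R)\<close>, where \<open>c\<close> is the centre
  of the balls, which gives the tail term.
\<close>

section \<open>Elementary inequalities for powers\<close>

text \<open>
  Young's inequality for the product of \<open>b\<close> and \<open>a powr (p - 1)\<close>: the graph of \<open>b \<mapsto> b powr p\<close> lies above
  its tangent at \<open>a\<close>. Stated in this form it includes the boundary point \<open>0\<close>.
\<close>

lemma powr_tangent:
  fixes a b p :: real
  assumes "1 < p" "0 \<le> a" "0 \<le> b"
  shows "p * b * a powr (p - 1) \<le> b powr p + (p - 1) * a powr p"
proof -
  have c: "1 / p + 1 / (p / (p - 1)) = 1"
    using assms by (simp add: field_simps)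
  have "p / (p - 1) > 1"
    using assms by (simp add: field_simps)
  with c have "b * a powr (p - 1)
      \<le> b powr p / p + (a powr (p - 1)) powr (p / (p - 1)) / (p / (p - 1))"
    using assms by (intro Youngs_inequality) auto
  also have "(a powr (p - 1)) powr (p / (p - 1)) = a powr p"
    using assms by (simp add: powr_powr)
  finally have "p * (b * a powr (p - 1)) \<le> p * (b powr p / p + a powr p / (p / (p - 1)))"
    using assms by (intro mult_left_mono) auto
  also have "\<dots> = b powr p + (p - 1) * a powr p"
    using assms by (simp add: field_simps)
  finally show ?thesis by (simp add: mult.assoc)
qed

lemma mult_powr_minus_one:
  fixes a p :: real
  assumes "0 \<le> a" "1 < p"
  shows "a * a powr (p - 1) = a powr p"
  using assms powr_mult_base[of a "p - 1"] by simp

lemma powr_diff_le: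
  fixes a b p :: real
  assumes "1 < p" "0 \<le> a" "0 \<le> b"
  shows "a powr p - b powr p \<le> p * a powr (p - 1) * (a - b)"
  using powr_tangent[OF assms] mult_powr_minus_one[OF assms(2,1)]
  by (simp add: algebra_simps)

text \<open>
  Convexity on the closed half line, obtained by weighting the tangent inequalities at the combined point.
\<close>

lemma powr_convex_comb:
  fixes a b p t :: real
  assumes "1 < p" "0 \<le> a" "0 \<le> b" "0 \<le> t" "t \<le> 1"
  shows "((1 - t) * a + t * b) powr p \<le> (1 - t) * a powr p + t * b powr p"
proof -
  define c where "c = (1 - t) * a + t * b"
  have c: "0 \<le> c" using assms by (simp add: c_def)
  have 1: "(1 - t) * (c powr p - a powr p) \<le> (1 - t) * (p * c powr (p - 1) * (c - a))"
    using assms c by (intro mult_left_mono powr_diff_le) auto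
  have 2: "t * (c powr p - b powr p) \<le> t * (p * c powr (p - 1) * (c - b))"
    using assms c by (intro mult_left_mono powr_diff_le) auto
  have "(1 - t) * (p * c powr (p - 1) * (c - a)) + t * (p * c powr (p - 1) * (c - b))
     = p * c powr (p - 1) * (c - ((1 - t) * a + t * b))"
    by (simp add: algebra_simps)
  also have "\<dots> = 0" by (simp add: c_def)
  finally show ?thesis using 1 2 unfolding c_def[symmetric] by (simp add: algebra_simps)
qed

text \<open>
  Both points lie where \<open>w\<close> is positive. With \<open>t = e1 powr p\<close> the left difference is
  \<open>(1 - t) * (w1 - w2) - t * d\<close>, and convexity separates the two terms. The factor \<open>e1 powr (p - 1)\<close> in
  the bound for \<open>e1 powr p - e2 powr p\<close> is exactly what compensates the division by \<open>t\<close> in \<open>d\<close>, so the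
  resulting error does not degenerate as \<open>e1\<close> tends to \<open>0\<close>.
\<close>

lemma truncation_both_above:
  fixes e1 e2 w1 w2 p :: real
  assumes p: "1 < p" and e: "0 \<le> e2" "e2 \<le> e1" "e1 \<le> 1" and w: "0 \<le> w2"
  shows "\<bar>(1 - e1 powr p) * w1 - (1 - e2 powr p) * w2\<bar> powr p + e1 powr p * \<bar>w1 - w2\<bar> powr p
    \<le> \<bar>w1 - w2\<bar> powr p + p powr p * \<bar>e1 - e2\<bar> powr p * w2 powr p"
proof (cases "e1 = 0")
  case True
  then show ?thesis using e by (simp add: w)
next
  case False
  then have e1: "e1 > 0" using e by simp
  define t where "t = e1 powr p"
  have t: "0 < t" "t \<le> 1" using e1 e p by (auto simp: t_def powr_le1)
  define d where "d = (e1 powr p - e2 powr p) * w2 / t"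
  have e21: "e2 powr p \<le> e1 powr p" using e p by (intro powr_mono2) auto
  then have d0: "0 \<le> d" using t w by (simp add: d_def)
  \<comment> \<open>The next steps show \<open>e1 * d \<le> p * (e1 - e2) * w2\<close>, whose \<open>p\<close>-th power bounds \<open>t * d powr p\<close>.\<close>
  have "e1 powr p - e2 powr p \<le> p * e1 powr (p - 1) * (e1 - e2)"
    using e p by (intro powr_diff_le) auto
  then have "t * d \<le> p * e1 powr (p - 1) * (e1 - e2) * w2"
    using t w by (auto simp: d_def intro: mult_right_mono)
  then have "e1 * (t * d) \<le> e1 * (p * e1 powr (p - 1) * (e1 - e2) * w2)"
    using e1 by simp
  also have "\<dots> = (e1 * e1 powr (p - 1)) * (p * (e1 - e2) * w2)"
    by (simp add: algebra_simps)
  also have "\<dots> = t * (p * (e1 - e2) * w2)"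
    using e1 p by (simp add: mult_powr_minus_one t_def)
  finally have "e1 * d \<le> p * (e1 - e2) * w2" using t by simp
  then have "(e1 * d) powr p \<le> (p * (e1 - e2) * w2) powr p"
    using e1 d0 p by (intro powr_mono2) auto
  then have td: "t * d powr p \<le> p powr p * \<bar>e1 - e2\<bar> powr p * w2 powr p"
    using e1 d0 p e w by (simp add: powr_mult t_def)
  have "t * d = (t - e2 powr p) * w2"
    using t by (simp add: d_def t_def)
  then have "(1 - e1 powr p) * w1 - (1 - e2 powr p) * w2 = (1 - t) * (w1 - w2) - t * d"
    by (simp add: t_def algebra_simps)
  then have "\<bar>(1 - e1 powr p) * w1 - (1 - e2 powr p) * w2\<bar> \<le> \<bar>(1 - t) * (w1 - w2)\<bar> + \<bar>t * d\<bar>"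
    by linarith
  also have "\<dots> = (1 - t) * \<bar>w1 - w2\<bar> + t * d"
    using t d0 by (simp add: abs_mult)
  finally have "\<bar>(1 - e1 powr p) * w1 - (1 - e2 powr p) * w2\<bar> powr p
      \<le> ((1 - t) * \<bar>w1 - w2\<bar> + t * d) powr p"
    using p by (intro powr_mono2) auto
  also have "\<dots> \<le> (1 - t) * \<bar>w1 - w2\<bar> powr p + t * d powr p"
    using t d0 p by (intro powr_convex_comb) auto
  finally show ?thesis using td by (simp add: t_def algebra_simps)
qed

text \<open>
  One point lies where \<open>w\<close> is positive, the other where \<open>m\<close> is. Since \<open>(1 - t) W + m\<close> is a convex
  combination of \<open>W + m\<close> and \<open>m\<close>, the truncation gains \<open>t\<close> times \<open>(W + m) powr p - m powr p\<close>, and this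
  difference dominates both \<open>W powr p\<close> and \<open>W * m powr (p - 1)\<close>, hence their average.
\<close>

lemma truncation_across:
  fixes t W m p :: real
  assumes p: "1 < p" and t: "0 \<le> t" "t \<le> 1" and W: "0 \<le> W" and m: "0 \<le> m"
  shows "((1 - t) * W + m) powr p + t / 2 * (W powr p + W * m powr (p - 1)) \<le> (W + m) powr p"
proof -
  have "((1 - t) * W + m) powr p = ((1 - t) * (W + m) + t * m) powr p"
    by (simp add: algebra_simps)
  also have "\<dots> \<le> (1 - t) * (W + m) powr p + t * m powr p"
    using assms by (intro powr_convex_comb) auto
  finally have 1: "((1 - t) * W + m) powr p \<le> (W + m) powr p - t * ((W + m) powr p - m powr p)"
    by (simp add: algebra_simps)
  have Wm: "W powr (p - 1) \<le> (W + m) powr (p - 1)" "m powr (p - 1) \<le> (W + m) powr (p - 1)"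
    using assms by (auto intro!: powr_mono2)
  have "W powr p + m * m powr (p - 1) \<le> W * (W + m) powr (p - 1) + m * (W + m) powr (p - 1)"
    using Wm W m p by (auto simp: mult_powr_minus_one[symmetric] intro!: add_mono mult_left_mono)
  also have "\<dots> = (W + m) powr p"
    using W m p by (simp add: mult_powr_minus_one[symmetric, of "W + m"] algebra_simps)
  finally have a: "W powr p \<le> (W + m) powr p - m powr p"
    using m p by (simp add: mult_powr_minus_one)
  have "(W + m) * m powr (p - 1) \<le> (W + m) * (W + m) powr (p - 1)"
    using Wm W m by (intro mult_left_mono) auto
  then have b: "W * m powr (p - 1) \<le> (W + m) powr p - m powr p"
    using W m p mult_powr_minus_one[of "W + m" p] mult_powr_minus_one[of m p]
    by (simp add: distrib_right)
  have "t * ((W powr p + W * m powr (p - 1)) / 2) \<le> t * ((W + m) powr p - m powr p)"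
    using a b t by (intro mult_left_mono) auto
  with 1 show ?thesis by simp
qed

text \<open>
  Shrinking \<open>W\<close> can only increase the distance to \<open>V\<close> when it leads below \<open>V\<close>; then the new distance is at
  most \<open>V\<close> and has grown by at most \<open>t * W\<close>. The bound is linear in \<open>W\<close> and of order \<open>p - 1\<close> in \<open>V\<close>, as
  needed for a tail.
\<close>

lemma truncation_far:
  fixes t W V p :: real
  assumes p: "1 < p" and t: "0 \<le> t" "t \<le> 1" and W: "0 \<le> W" and V: "0 \<le> V"
  shows "\<bar>(1 - t) * W - V\<bar> powr p \<le> \<bar>W - V\<bar> powr p + p * (t * W * V powr (p - 1))"
proof -
  have tW: "0 \<le> t * W" "t * W \<le> W" using t W by (auto simp: mult_left_le_one_le)
  show ?thesis
  proof (cases "\<bar>(1 - t) * W - V\<bar> \<le> \<bar>W - V\<bar>")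
    case True
    then have "\<bar>(1 - t) * W - V\<bar> powr p \<le> \<bar>W - V\<bar> powr p"
      using p by (intro powr_mono2) auto
    moreover have "0 \<le> p * (t * W * V powr (p - 1))" using tW p by auto
    ultimately show ?thesis by linarith
  next
    case False
    define a where "a = \<bar>(1 - t) * W - V\<bar>"
    define b where "b = \<bar>W - V\<bar>"
    have ab: "0 \<le> a" "0 \<le> b" "b < a" "a - b \<le> t * W" "a \<le> V"
      using False tW W V unfolding a_def b_def by (auto simp: algebra_simps abs_if split: if_splits)
    have "a powr p - b powr p \<le> p * a powr (p - 1) * (a - b)"
      using ab p by (intro powr_diff_le) auto
    also have "\<dots> \<le> p * V powr (p - 1) * (t * W)"
      using ab p by (intro mult_mono powr_mono2) auto
    finally show ?thesis by (simp add: a_def b_def algebra_simps)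
  qed
qed

section \<open>Lebesgue measurability and iterated integrals on the product space\<close>

text \<open>
  A Lebesgue measurable function agrees with a Borel function off a null set, and the cylinder over a null
  set is null. Completeness of the Lebesgue measure on the product then gives measurability.
\<close>

lemma borel_measurable_lebesgue_fst:
  fixes u :: "'a::euclidean_space \<Rightarrow> real"
  assumes "u \<in> borel_measurable lebesgue"
  shows "(\<lambda>z. u (fst z)) \<in> borel_measurable (lebesgue :: ('a \<times> 'b::euclidean_space) measure)"
proof -
  obtain g where g: "g \<in> borel_measurable lborel" "AE x in lborel. u x = g x"
    using completion_ex_borel_measurable_real[OF assms] by auto
  obtain N where N: "N \<in> null_sets lborel" "{x. u x \<noteq> g x} \<subseteq> N"
    using g(2) by (auto simp: eventually_ae_filter)
  have "emeasure (lborel \<Otimes>\<^sub>M lborel) (N \<times> (UNIV :: 'b set)) = 0"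
    using N by (simp add: lborel.emeasure_pair_measure_Times null_sets_def)
  then have "N \<times> (UNIV :: 'b set) \<in> null_sets lborel"
    using N by (simp add: lborel_prod[symmetric] null_sets_def)
  then have "AE z :: 'a \<times> 'b in lborel. g (fst z) = u (fst z)"
    by (rule AE_I') (use N in auto)
  moreover have "(\<lambda>z. g (fst z)) \<in> borel_measurable (lebesgue :: ('a \<times> 'b) measure)"
    using g(1) by (intro measurable_completion) (simp flip: lborel_prod)
  ultimately show ?thesis
    by (auto intro: borel_measurable_AE AE_completion)
qed

lemma borel_measurable_lebesgue_snd:
  fixes u :: "'b::euclidean_space \<Rightarrow> real"
  assumes "u \<in> borel_measurable lebesgue"
  shows "(\<lambda>z. u (snd z)) \<in> borel_measurable (lebesgue :: ('a::euclidean_space \<times> 'b) measure)"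
proof -
  obtain g where g: "g \<in> borel_measurable lborel" "AE x in lborel. u x = g x"
    using completion_ex_borel_measurable_real[OF assms] by auto
  obtain N where N: "N \<in> null_sets lborel" "{x. u x \<noteq> g x} \<subseteq> N"
    using g(2) by (auto simp: eventually_ae_filter)
  have "emeasure (lborel \<Otimes>\<^sub>M lborel) ((UNIV :: 'a set) \<times> N) = 0"
    using N by (subst lborel.emeasure_pair_measure_Times) (auto simp: null_sets_def)
  then have "(UNIV :: 'a set) \<times> N \<in> null_sets lborel"
    using N by (simp add: lborel_prod[symmetric] null_sets_def)
  then have "AE z :: 'a \<times> 'b in lborel. g (snd z) = u (snd z)"
    by (rule AE_I') (use N in auto)
  moreover have "(\<lambda>z. g (snd z)) \<in> borel_measurable (lebesgue :: ('a \<times> 'b) measure)"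
    using g(1) by (intro measurable_completion) (simp flip: lborel_prod)
  ultimately show ?thesis
    by (auto intro: borel_measurable_AE AE_completion)
qed

lemma borel_measurable_norm_diff_lebesgue:
  "(\<lambda>z. norm (fst z - snd z)) \<in> borel_measurable (lebesgue :: ('a::euclidean_space \<times> 'a) measure)"
proof -
  have "(\<lambda>z :: 'a \<times> 'a. norm (fst z - snd z)) \<in> borel_measurable borel"
    by (intro borel_measurable_continuous_onI continuous_intros)
  then show ?thesis by (intro measurable_completion) simp
qed

text \<open>
  Tonelli's theorem for the completed measures. The Lebesgue measure on the product is not the product of
  the Lebesgue measures, but it is the completion of the product of the Borel--Lebesgue measures, so
  the theorem passes over from a Borel representative.
\<close>

lemma nn_integral_lebesgue_iterated:
  fixes f :: "'a::euclidean_space \<times> 'b::euclidean_space \<Rightarrow> ennreal"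
  assumes "f \<in> borel_measurable lebesgue"
  shows "(\<integral>\<^sup>+z. f z \<partial>lebesgue) = (\<integral>\<^sup>+x. (\<integral>\<^sup>+y. f (x, y) \<partial>lebesgue) \<partial>lebesgue)"
    and "(\<integral>\<^sup>+z. f z \<partial>lebesgue) = (\<integral>\<^sup>+y. (\<integral>\<^sup>+x. f (x, y) \<partial>lebesgue) \<partial>lebesgue)"
proof -
  obtain g where g: "g \<in> borel_measurable lborel" "AE z in lborel. f z = g z"
    using completion_ex_borel_measurable[OF assms] by auto
  have gm [measurable]: "g \<in> borel_measurable (lborel \<Otimes>\<^sub>M lborel)"
    using g(1) by (simp only: lborel_prod)
  have ae: "AE z in lborel \<Otimes>\<^sub>M lborel. f z = g z"
    using g(2) by (simp only: lborel_prod)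
  have ae1: "AE x in lborel. AE y in lborel. f (x, y) = g (x, y)"
    using lborel_pair.AE_pair[OF ae] .
  have "AE z in lborel \<Otimes>\<^sub>M lborel. f (case z of (x, y) \<Rightarrow> (y, x)) = g (case z of (x, y) \<Rightarrow> (y, x))"
    using ae by (subst (asm) lborel_pair.distr_pair_swap) (rule AE_distrD[OF measurable_pair_swap'])
  then have ae2: "AE y in lborel. AE x in lborel. f (x, y) = g (x, y)"
    using lborel_pair.AE_pair by fastforce
  have "(\<integral>\<^sup>+z. f z \<partial>lebesgue) = (\<integral>\<^sup>+z. g z \<partial>(lborel \<Otimes>\<^sub>M lborel))"
    unfolding nn_integral_completion lborel_prod using g(2) by (rule nn_integral_cong_AE)
  moreover have "(\<integral>\<^sup>+z. g z \<partial>(lborel \<Otimes>\<^sub>M lborel))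
      = (\<integral>\<^sup>+x. (\<integral>\<^sup>+y. g (x, y) \<partial>lborel) \<partial>lborel)"
    by (simp add: lborel.nn_integral_fst[symmetric])
  moreover have "\<dots> = (\<integral>\<^sup>+x. (\<integral>\<^sup>+y. f (x, y) \<partial>lebesgue) \<partial>lebesgue)"
    unfolding nn_integral_completion using ae1
    by (intro nn_integral_cong_AE) (auto elim!: eventually_mono intro!: nn_integral_cong_AE)
  ultimately show "(\<integral>\<^sup>+z. f z \<partial>lebesgue) = (\<integral>\<^sup>+x. (\<integral>\<^sup>+y. f (x, y) \<partial>lebesgue) \<partial>lebesgue)"
    by simp
  have "(\<integral>\<^sup>+z. g z \<partial>(lborel \<Otimes>\<^sub>M lborel))
      = (\<integral>\<^sup>+y. (\<integral>\<^sup>+x. g (x, y) \<partial>lborel) \<partial>lborel)"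
    by (simp add: lborel_pair.nn_integral_snd[symmetric])
  moreover have "\<dots> = (\<integral>\<^sup>+y. (\<integral>\<^sup>+x. f (x, y) \<partial>lebesgue) \<partial>lebesgue)"
    unfolding nn_integral_completion using ae2
    by (intro nn_integral_cong_AE) (auto elim!: eventually_mono intro!: nn_integral_cong_AE)
  ultimately show "(\<integral>\<^sup>+z. f z \<partial>lebesgue) = (\<integral>\<^sup>+y. (\<integral>\<^sup>+x. f (x, y) \<partial>lebesgue) \<partial>lebesgue)"
    using \<open>(\<integral>\<^sup>+z. f z \<partial>lebesgue) = (\<integral>\<^sup>+z. g z \<partial>(lborel \<Otimes>\<^sub>M lborel))\<close> by simp
qed

text \<open>
  Both error integrals have the form of a weight in one variable times a kernel whose slices are bounded
  uniformly on the support of that weight.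
\<close>

lemma nn_integral_weighted_slices:
  fixes a :: "'a::euclidean_space \<Rightarrow> real" and g :: "'a \<Rightarrow> 'b::euclidean_space \<Rightarrow> real"
  assumes f: "(\<lambda>z. ennreal (a (fst z) * g (fst z) (snd z))) \<in> borel_measurable lebesgue"
    and a: "a \<in> borel_measurable lebesgue" "\<And>x. 0 \<le> a x"
    and g: "\<And>x. g x \<in> borel_measurable lebesgue"
    and bound: "\<And>x. a x \<noteq> 0 \<Longrightarrow> (\<integral>\<^sup>+y. ennreal (g x y) \<partial>lebesgue) \<le> c"
  shows "(\<integral>\<^sup>+z. ennreal (a (fst z) * g (fst z) (snd z)) \<partial>lebesgue) \<le> c * (\<integral>\<^sup>+x. ennreal (a x) \<partial>lebesgue)"
proof -
  have "(\<integral>\<^sup>+z. ennreal (a (fst z) * g (fst z) (snd z)) \<partial>lebesgue)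
      = (\<integral>\<^sup>+x. (\<integral>\<^sup>+y. ennreal (a x * g x y) \<partial>lebesgue) \<partial>lebesgue)"
    using nn_integral_lebesgue_iterated(1)[OF f] by simp
  also have "\<dots> \<le> (\<integral>\<^sup>+x. c * ennreal (a x) \<partial>lebesgue)"
  proof (rule nn_integral_mono)
    fix x
    have "(\<integral>\<^sup>+y. ennreal (a x * g x y) \<partial>lebesgue) = ennreal (a x) * (\<integral>\<^sup>+y. ennreal (g x y) \<partial>lebesgue)"
      using g a by (simp add: ennreal_mult' nn_integral_cmult)
    also have "\<dots> \<le> ennreal (a x) * c"
      using bound[of x] by (cases "a x = 0") (auto intro: mult_left_mono)
    finally show "(\<integral>\<^sup>+y. ennreal (a x * g x y) \<partial>lebesgue) \<le> c * ennreal (a x)"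
      by (simp add: mult.commute)
  qed
  also have "\<dots> = c * (\<integral>\<^sup>+x. ennreal (a x) \<partial>lebesgue)"
    using a by (intro nn_integral_cmult) auto
  finally show ?thesis .
qed

lemma nn_integral_lebesgue_swap:
  fixes f :: "'a::euclidean_space \<times> 'b::euclidean_space \<Rightarrow> ennreal"
  assumes "f \<in> borel_measurable lebesgue" "(\<lambda>z. f (snd z, fst z)) \<in> borel_measurable lebesgue"
  shows "(\<integral>\<^sup>+z. f (snd z, fst z) \<partial>lebesgue) = (\<integral>\<^sup>+z. f z \<partial>lebesgue)"
  using nn_integral_lebesgue_iterated(1)[OF assms(2)] nn_integral_lebesgue_iterated(2)[OF assms(1)]
  by simp

section \<open>Singular kernels on balls and on their complements\<close>

lemma dyadic_bracket:
  fixes t :: real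
  assumes "1 \<le> t"
  shows "\<exists>j. 2 ^ j \<le> t \<and> t < 2 ^ Suc j"
proof -
  define m where "m = (LEAST m. t < 2 ^ m)"
  have m: "t < 2 ^ m"
    unfolding m_def using real_arch_pow[of 2 t] by (auto intro: LeastI)
  then obtain j where j: "m = Suc j"
    using assms by (cases m) auto
  have "\<not> t < 2 ^ j"
    using not_less_Least[of j "\<lambda>m. t < 2 ^ m"] j by (simp add: m_def)
  with m j show ?thesis by (auto intro!: exI[of _ j])
qed

text \<open>
  Dyadic integration in place of polar coordinates: it suffices that each point where \<open>f\<close> is positive lies
  in one of the balls on which \<open>f\<close> is bounded by the corresponding constant.
\<close>

lemma nn_integral_le_sum_balls:
  fixes f :: "'a::euclidean_space \<Rightarrow> real" and c :: 'a
  assumes cover: "\<And>x. 0 < f x \<Longrightarrow> \<exists>j. dist c x \<le> \<rho> j \<and> f x \<le> a j"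
    and nonneg: "\<And>j. 0 \<le> a j" "\<And>j. 0 \<le> \<rho> j"
    and sums: "(\<lambda>j. a j * \<rho> j ^ DIM('a)) sums S"
  shows "(\<integral>\<^sup>+x. ennreal (f x) \<partial>lebesgue) \<le> ennreal (unit_ball_vol (DIM('a)) * S)"
proof -
  have "(\<integral>\<^sup>+x. ennreal (f x) \<partial>lebesgue)
      \<le> (\<integral>\<^sup>+x. (\<Sum>j. ennreal (a j) * indicator (cball c (\<rho> j)) x) \<partial>lborel)"
    unfolding nn_integral_completion
  proof (rule nn_integral_mono)
    fix x
    show "ennreal (f x) \<le> (\<Sum>j. ennreal (a j) * indicator (cball c (\<rho> j)) x)"
    proof (cases "0 < f x")
      case True
      with cover obtain j where j: "dist c x \<le> \<rho> j" "f x \<le> a j" by blast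
      define g where "g = (\<lambda>i. ennreal (a i) * indicator (cball c (\<rho> i)) x)"
      have "ennreal (f x) \<le> g j"
        using j by (simp add: ennreal_leI g_def)
      also have "\<dots> \<le> suminf g"
        using sum_le_suminf[of g "{j}"] by simp
      also have "\<dots> = (\<Sum>j. ennreal (a j) * indicator (cball c (\<rho> j)) x)"
        by (simp only: g_def)
      finally show ?thesis .
    qed (simp add: ennreal_neg)
  qed
  also have "\<dots> = (\<Sum>j. \<integral>\<^sup>+x. ennreal (a j) * indicator (cball c (\<rho> j)) x \<partial>lborel)"
    by (rule nn_integral_suminf) (auto intro!: borel_measurable_times_ennreal borel_measurable_indicator)
  also have "\<dots> = (\<Sum>j. ennreal (unit_ball_vol (DIM('a)) * (a j * \<rho> j ^ DIM('a))))"
    using nonneg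
    by (simp add: nn_integral_cmult_indicator emeasure_cball ennreal_mult[symmetric] mult_ac)
  also have "\<dots> = ennreal (unit_ball_vol (DIM('a)) * S)"
    using nonneg sums_mult[OF sums, of "unit_ball_vol (DIM('a))"]
    by (intro suminf_ennreal_eq) auto
  finally show ?thesis .
qed

text \<open>
  The sum of the dyadic estimates for the integral of \<open>norm x powr (\<beta> - n)\<close> over the unit ball of
  \<open>n\<close>-dimensional space. It is an upper bound, not the exact value.
\<close>

definition ball_kernel_const :: "real \<Rightarrow> real \<Rightarrow> real" where
  "ball_kernel_const n \<beta> = unit_ball_vol n * (2 powr n / (1 - 2 powr - \<beta>))"

lemma ball_kernel_const_pos:
  assumes "0 < \<beta>" "0 \<le> n"
  shows "0 < ball_kernel_const n \<beta>"
  using assms unfolding ball_kernel_const_def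
  by (auto intro!: mult_pos_pos divide_pos_pos simp: powr_minus_divide field_simps)

lemma sums_dyadic_powr:
  fixes \<beta> :: real
  assumes "0 < \<beta>"
  shows "(\<lambda>j. ((1 / 2) ^ j) powr \<beta>) sums (1 / (1 - 2 powr - \<beta>))"
proof -
  have "((1 / 2) ^ j) powr \<beta> = (2 powr - \<beta>) ^ j" for j :: nat
    by (simp add: powr_minus powr_divide powr_power powr_realpow[symmetric] powr_powr mult.commute
        power_one_over inverse_eq_divide)
  then show ?thesis
    using assms geometric_sums[of "2 powr - \<beta> :: real"] by (simp add: powr_less_one)
qed

text \<open>
  On the shell \<open>\<rho> j / 2 < norm (x - c) \<le> \<rho> j\<close> the integrand is at most \<open>2 powr n * \<rho> j powr (\<beta> - n)\<close>,
  whatever the sign of \<open>\<beta> - n\<close>; multiplied by the volume of the ball of radius \<open>\<rho> j\<close> this is a geometric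
  sequence because \<open>\<beta>\<close> is positive.
\<close>

lemma nn_integral_kernel_ball:
  fixes c :: "'a::euclidean_space" and \<beta> :: real
  assumes "0 < \<beta>" "0 < R"
  shows "(\<integral>\<^sup>+x. ennreal (indicat_real (ball c R) x * norm (x - c) powr (\<beta> - DIM('a))) \<partial>lebesgue)
    \<le> ennreal (ball_kernel_const (DIM('a)) \<beta> * R powr \<beta>)"
proof -
  let ?n = "real DIM('a)"
  define \<rho> :: "nat \<Rightarrow> real" where "\<rho> j = (1 / 2) ^ j * R" for j
  have \<rho>: "0 < \<rho> j" for j using assms by (simp add: \<rho>_def)
  have "(\<integral>\<^sup>+x. ennreal (indicat_real (ball c R) x * norm (x - c) powr (\<beta> - ?n)) \<partial>lebesgue)
    \<le> ennreal (unit_ball_vol ?n * (2 powr ?n * R powr \<beta> * (1 / (1 - 2 powr - \<beta>))))"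
  proof (rule nn_integral_le_sum_balls[where c = c and \<rho> = \<rho> and a = "\<lambda>j. 2 powr ?n * \<rho> j powr (\<beta> - ?n)"])
    fix x
    assume "0 < indicat_real (ball c R) x * norm (x - c) powr (\<beta> - ?n)"
    then have x: "dist c x < R" "x \<noteq> c"
      by (auto simp: indicator_def of_bool_def split: if_splits)
    define d where "d = norm (x - c)"
    have d: "0 < d" "d < R" using x by (auto simp: d_def dist_norm norm_minus_commute)
    then obtain j where j: "2 ^ j \<le> R / d" "R / d < 2 ^ Suc j"
      using dyadic_bracket[of "R / d"] by (auto simp: field_simps)
    have dj: "d \<le> \<rho> j" "\<rho> j \<le> 2 * d"
      using j d by (auto simp: \<rho>_def field_simps)
    have "d powr (\<beta> - ?n) \<le> 2 powr ?n * \<rho> j powr (\<beta> - ?n)"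
    proof (cases "\<beta> \<ge> ?n")
      case True
      then have "d powr (\<beta> - ?n) \<le> 1 * \<rho> j powr (\<beta> - ?n)"
        using d dj by (auto intro: powr_mono2)
      also have "\<dots> \<le> 2 powr ?n * \<rho> j powr (\<beta> - ?n)"
        by (intro mult_right_mono) (auto simp: ge_one_powr_ge_zero)
      finally show ?thesis .
    next
      case False
      then have "(2 * d) powr (\<beta> - ?n) \<le> \<rho> j powr (\<beta> - ?n)"
        using \<rho>[of j] dj by (intro powr_mono2') auto
      then have "2 powr ?n * (2 powr (\<beta> - ?n) * d powr (\<beta> - ?n)) \<le> 2 powr ?n * \<rho> j powr (\<beta> - ?n)"
        using d by (simp add: powr_mult)
      moreover have "1 * d powr (\<beta> - ?n) \<le> 2 powr \<beta> * d powr (\<beta> - ?n)"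
        using assms by (intro mult_right_mono) (auto simp: ge_one_powr_ge_zero)
      moreover have "(2::real) powr ?n * 2 powr (\<beta> - ?n) = 2 powr \<beta>"
        by (simp flip: powr_add)
      ultimately show ?thesis by (simp flip: mult.assoc)
    qed
    then show "\<exists>j. dist c x \<le> \<rho> j
        \<and> indicat_real (ball c R) x * norm (x - c) powr (\<beta> - ?n) \<le> 2 powr ?n * \<rho> j powr (\<beta> - ?n)"
      using dj x by (intro exI[of _ j]) (auto simp: d_def dist_norm norm_minus_commute)
  next
    have "2 powr ?n * \<rho> j powr (\<beta> - ?n) * \<rho> j ^ DIM('a) = 2 powr ?n * R powr \<beta> * ((1 / 2) ^ j) powr \<beta>" for j
    proof -
      have "\<rho> j powr (\<beta> - ?n) * \<rho> j ^ DIM('a) = \<rho> j powr \<beta>"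
        using \<rho>[of j] by (simp add: powr_realpow[symmetric] powr_add[symmetric])
      also have "\<dots> = R powr \<beta> * ((1 / 2) ^ j) powr \<beta>"
        unfolding \<rho>_def using assms by (subst powr_mult) auto
      finally show ?thesis by (simp add: mult.assoc)
    qed
    then show "(\<lambda>j. 2 powr ?n * \<rho> j powr (\<beta> - ?n) * \<rho> j ^ DIM('a))
        sums (2 powr ?n * R powr \<beta> * (1 / (1 - 2 powr - \<beta>)))"
      by (simp only:) (rule sums_mult[OF sums_dyadic_powr[OF assms(1)]])
  qed (use \<rho> in \<open>auto intro: less_imp_le\<close>)
  then show ?thesis by (simp add: ball_kernel_const_def mult_ac)
qed

text \<open>
  The same dyadic argument with growing radii. It shows that constants have finite tails.
\<close>

lemma nn_integral_kernel_outside_ball_finite: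
  fixes c :: "'a::euclidean_space" and \<beta> :: real
  assumes "0 < \<beta>" "0 < r"
  shows "(\<integral>\<^sup>+x. ennreal (indicat_real (- ball c r) x / norm (x - c) powr (DIM('a) + \<beta>)) \<partial>lebesgue) < \<infinity>"
proof -
  let ?n = "real DIM('a)"
  define \<rho> :: "nat \<Rightarrow> real" where "\<rho> j = 2 ^ j * r" for j
  have \<rho>: "0 < \<rho> j" for j using assms by (simp add: \<rho>_def)
  have "(\<integral>\<^sup>+x. ennreal (indicat_real (- ball c r) x / norm (x - c) powr (?n + \<beta>)) \<partial>lebesgue)
    \<le> ennreal (unit_ball_vol ?n * (2 ^ DIM('a) * r powr - \<beta> * (1 / (1 - 2 powr - \<beta>))))"
  proof (rule nn_integral_le_sum_balls[where c = c and \<rho> = "\<lambda>j. 2 * \<rho> j" and a = "\<lambda>j. \<rho> j powr - (?n + \<beta>)"])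
    fix x
    assume "0 < indicat_real (- ball c r) x / norm (x - c) powr (?n + \<beta>)"
    then have x: "r \<le> dist c x"
      by (auto simp: indicator_def of_bool_def split: if_splits)
    define d where "d = norm (x - c)"
    have d: "0 < d" "r \<le> d" using x assms by (auto simp: d_def dist_norm norm_minus_commute)
    then obtain j where j: "2 ^ j \<le> d / r" "d / r < 2 ^ Suc j"
      using dyadic_bracket[of "d / r"] assms by (auto simp: field_simps)
    have dj: "\<rho> j \<le> d" "d \<le> 2 * \<rho> j"
      using j assms by (auto simp: \<rho>_def field_simps)
    have "d powr - (?n + \<beta>) \<le> \<rho> j powr - (?n + \<beta>)"
      using \<rho>[of j] dj assms by (intro powr_mono2') auto
    moreover have "1 / d powr (?n + \<beta>) = d powr - (?n + \<beta>)"
      by (simp only: powr_minus_divide)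
    ultimately show "\<exists>j. dist c x \<le> 2 * \<rho> j
        \<and> indicat_real (- ball c r) x / norm (x - c) powr (?n + \<beta>) \<le> \<rho> j powr - (?n + \<beta>)"
      using dj x by (intro exI[of _ j])
        (auto simp: d_def dist_norm norm_minus_commute)
  next
    have "\<rho> j powr - (?n + \<beta>) * (2 * \<rho> j) ^ DIM('a)
        = 2 ^ DIM('a) * r powr - \<beta> * ((1 / 2) ^ j) powr \<beta>" for j
    proof -
      have "\<rho> j powr - (?n + \<beta>) * \<rho> j ^ DIM('a) = \<rho> j powr - \<beta>"
        using \<rho>[of j] by (simp add: powr_realpow[symmetric] powr_add[symmetric])
      also have "\<dots> = (2 ^ j) powr - \<beta> * r powr - \<beta>"
        unfolding \<rho>_def using assms by (subst powr_mult) auto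
      also have "((2::real) ^ j) powr - \<beta> = ((1 / 2) ^ j) powr \<beta>"
        by (simp add: powr_minus powr_divide power_one_over inverse_eq_divide)
      finally show ?thesis by (simp add: power_mult_distrib mult_ac)
    qed
    then show "(\<lambda>j. \<rho> j powr - (?n + \<beta>) * (2 * \<rho> j) ^ DIM('a))
        sums (2 ^ DIM('a) * r powr - \<beta> * (1 / (1 - 2 powr - \<beta>)))"
      by (simp only:) (rule sums_mult[OF sums_dyadic_powr[OF assms(1)]])
  qed (use \<rho> in \<open>auto intro: less_imp_le\<close>)
  also have "\<dots> < \<infinity>" by simp
  finally show ?thesis .
qed

section \<open>Cutoff functions\<close>

definition cutoff :: "'a::real_normed_vector \<Rightarrow> real \<Rightarrow> real \<Rightarrow> 'a \<Rightarrow> real" where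
  "cutoff c r R x = max 0 (min 1 ((R - dist c x) / (R - r)))"

lemma cutoff_bounds: "0 \<le> cutoff c r R x" "cutoff c r R x \<le> 1"
  by (auto simp: cutoff_def)

lemma cutoff_eq_1: "r < R \<Longrightarrow> x \<in> ball c r \<Longrightarrow> cutoff c r R x = 1"
  by (auto simp: cutoff_def)

lemma cutoff_eq_0: "r < R \<Longrightarrow> x \<notin> ball c R \<Longrightarrow> cutoff c r R x = 0"
  by (auto simp: cutoff_def divide_nonpos_pos)

lemma cutoff_lipschitz:
  assumes "r < R"
  shows "\<bar>cutoff c r R x - cutoff c r R y\<bar> \<le> norm (x - y) / (R - r)"
proof -
  have "\<bar>cutoff c r R x - cutoff c r R y\<bar> \<le> \<bar>(R - dist c x) / (R - r) - (R - dist c y) / (R - r)\<bar>"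
    unfolding cutoff_def by linarith
  also have "\<dots> = \<bar>dist c y - dist c x\<bar> / (R - r)"
    using assms by (simp add: diff_divide_distrib[symmetric])
  also have "\<dots> \<le> norm (x - y) / (R - r)"
    using assms abs_dist_diff_le[of y c x]
    by (intro divide_right_mono) (auto simp: dist_norm norm_minus_commute)
  finally show ?thesis .
qed

lemma borel_measurable_cutoff [measurable]:
  "cutoff c r R \<in> borel_measurable (lebesgue :: 'a::euclidean_space measure)"
proof -
  have "cutoff c r R \<in> borel_measurable (borel :: 'a measure)"
    unfolding cutoff_def[abs_def] divide_inverse
    by (intro borel_measurable_continuous_onI continuous_intros)
  then show ?thesis by (intro measurable_completion) simp
qed

text \<open>
  The Lipschitz bound for the cutoff turns the exponent \<open>-(n + s p)\<close> into \<open>(1 - s) p - n\<close>, which is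
  integrable. The ball of radius \<open>R\<close> around \<open>c\<close> is contained in the ball of radius \<open>2 R\<close> around \<open>x\<close>.
\<close>

lemma cutoff_kernel_bound:
  fixes x c :: "'a::euclidean_space" and p s r R R\<^sub>1 :: real
  assumes p: "1 < p" and s: "s < 1" and r: "0 < r" "r < R\<^sub>1" "R\<^sub>1 < R" and x: "x \<in> ball c R"
  shows "(\<integral>\<^sup>+y. ennreal (indicat_real (ball c R) y * \<bar>cutoff c r R\<^sub>1 x - cutoff c r R\<^sub>1 y\<bar> powr p
        / norm (x - y) powr (DIM('a) + s * p)) \<partial>lebesgue)
    \<le> ennreal (ball_kernel_const DIM('a) ((1 - s) * p) * (2 * R) powr ((1 - s) * p) / (R\<^sub>1 - r) powr p)"
proof -
  let ?N = "DIM('a) + s * p"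
  let ?b = "(1 - s) * p"
  have "(\<integral>\<^sup>+y. ennreal (indicat_real (ball c R) y * \<bar>cutoff c r R\<^sub>1 x - cutoff c r R\<^sub>1 y\<bar> powr p
        / norm (x - y) powr ?N) \<partial>lebesgue)
    \<le> (\<integral>\<^sup>+y. ennreal (1 / (R\<^sub>1 - r) powr p) * ennreal (indicat_real (ball x (2 * R)) y * norm (y - x) powr (?b - DIM('a))) \<partial>lebesgue)"
  proof (rule nn_integral_mono)
    fix y
    show "ennreal (indicat_real (ball c R) y * \<bar>cutoff c r R\<^sub>1 x - cutoff c r R\<^sub>1 y\<bar> powr p
        / norm (x - y) powr ?N)
      \<le> ennreal (1 / (R\<^sub>1 - r) powr p) * ennreal (indicat_real (ball x (2 * R)) y * norm (y - x) powr (?b - DIM('a)))"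
    proof (cases "y \<in> ball c R \<and> y \<noteq> x")
      case True
      then have y: "y \<in> ball x (2 * R)"
        using x dist_triangle[of x y c] by (auto simp: dist_commute)
      have "\<bar>cutoff c r R\<^sub>1 x - cutoff c r R\<^sub>1 y\<bar> powr p \<le> (norm (x - y) / (R\<^sub>1 - r)) powr p"
        using p r by (intro powr_mono2 cutoff_lipschitz) auto
      also have "\<dots> = norm (x - y) powr p / (R\<^sub>1 - r) powr p"
        using r by (simp add: powr_divide)
      finally have "\<bar>cutoff c r R\<^sub>1 x - cutoff c r R\<^sub>1 y\<bar> powr p / norm (x - y) powr ?N
          \<le> norm (x - y) powr p / (R\<^sub>1 - r) powr p / norm (x - y) powr ?N"
        by (rule divide_right_mono) simp
      also have "\<dots> = 1 / (R\<^sub>1 - r) powr p * (norm (x - y) powr p / norm (x - y) powr ?N)"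
        by simp
      also have "norm (x - y) powr p / norm (x - y) powr ?N = norm (y - x) powr (?b - DIM('a))"
        using True by (simp add: powr_diff[symmetric] norm_minus_commute algebra_simps)
      finally show ?thesis
        using True y by (simp add: ennreal_mult'[symmetric] ennreal_leI)
    next
      case False
      then show ?thesis by (auto simp: indicator_def)
    qed
  qed
  also have "\<dots> = ennreal (1 / (R\<^sub>1 - r) powr p)
      * (\<integral>\<^sup>+y. ennreal (indicat_real (ball x (2 * R)) y * norm (y - x) powr (?b - DIM('a))) \<partial>lebesgue)"
    unfolding nn_integral_completion
  proof (rule nn_integral_cmult)
    have [measurable]: "ball x (2 * R) \<in> sets borel" by simp
    show "(\<lambda>y. ennreal (indicat_real (ball x (2 * R)) y * norm (y - x) powr (?b - DIM('a)))) \<in> borel_measurable lborel"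
      by measurable
  qed
  also have "\<dots> \<le> ennreal (1 / (R\<^sub>1 - r) powr p) * ennreal (ball_kernel_const DIM('a) ?b * (2 * R) powr ?b)"
    using p s r by (intro mult_left_mono nn_integral_kernel_ball) auto
  finally show ?thesis
    by (simp add: ennreal_mult'[symmetric])
qed

text \<open>
  If \<open>x\<close> is in the ball of radius \<open>(R + r) / 2\<close> and \<open>y\<close> is off the ball of radius \<open>R\<close>, then
  \<open>norm (x - y) \<ge> norm (y - c) * (R - r) / (2 * R)\<close>, so the kernel centred at \<open>x\<close> is comparable with the
  one centred at \<open>c\<close>.
\<close>

lemma tail_kernel_bound:
  fixes x c :: "'a::euclidean_space" and q N r R :: real
  assumes N: "0 \<le> N" and r: "0 < r" "r < R" and x: "x \<in> ball c ((R + r) / 2)"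
    and w: "w \<in> borel_measurable lebesgue" "\<And>y. 0 \<le> w y"
  shows "(\<integral>\<^sup>+y. ennreal (indicat_real (- ball c R) y * w y powr q / norm (x - y) powr N) \<partial>lebesgue)
    \<le> ennreal ((2 * R / (R - r)) powr N)
      * (\<integral>\<^sup>+y. ennreal (indicat_real (- ball c r) y * (w y powr q / norm (y - c) powr N)) \<partial>lebesgue)"
proof -
  have "(\<integral>\<^sup>+y. ennreal (indicat_real (- ball c R) y * w y powr q / norm (x - y) powr N) \<partial>lebesgue)
    \<le> (\<integral>\<^sup>+y. ennreal ((2 * R / (R - r)) powr N)
        * ennreal (indicat_real (- ball c r) y * (w y powr q / norm (y - c) powr N)) \<partial>lebesgue)"
  proof (rule nn_integral_mono)
    fix y
    show "ennreal (indicat_real (- ball c R) y * w y powr q / norm (x - y) powr N)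
      \<le> ennreal ((2 * R / (R - r)) powr N)
        * ennreal (indicat_real (- ball c r) y * (w y powr q / norm (y - c) powr N))"
    proof (cases "y \<in> ball c R")
      case False
      define D where "D = norm (y - c)"
      have D: "R \<le> D" using False by (simp add: D_def dist_norm norm_minus_commute)
      have "D - norm (x - y) \<le> (R + r) / 2"
        using x norm_triangle_ineq[of "y - x" "x - c"]
        by (simp add: D_def dist_norm norm_minus_commute)
      moreover have "(R - r) / (2 * R) * D \<le> D - (R + r) / 2"
      proof -
        have "D - (R + r) / 2 - (R - r) / (2 * R) * D = (R + r) / (2 * R) * (D - R)"
          using r by (simp add: field_simps)
        moreover have "0 \<le> (R + r) / (2 * R) * (D - R)"
          using r D by (intro mult_nonneg_nonneg) auto
        ultimately show ?thesis by linarith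
      qed
      ultimately have "(R - r) / (2 * R) * D \<le> norm (x - y)"
        by linarith
      then have "((R - r) / (2 * R) * D) powr N \<le> norm (x - y) powr N"
        using N r D by (intro powr_mono2) auto
      then have "w y powr q / norm (x - y) powr N \<le> w y powr q / ((R - r) / (2 * R) * D) powr N"
        using r D by (intro divide_left_mono mult_pos_pos) (auto simp: dest: order_less_le_trans)
      also have "\<dots> = (2 * R / (R - r)) powr N * (w y powr q / D powr N)"
        using r D by (simp add: powr_mult powr_divide)
      finally show ?thesis
        using False r by (auto simp: ennreal_mult'[symmetric] ennreal_leI D_def)
    qed auto
  qed
  also have "\<dots> = ennreal ((2 * R / (R - r)) powr N)
      * (\<integral>\<^sup>+y. ennreal (indicat_real (- ball c r) y * (w y powr q / norm (y - c) powr N)) \<partial>lebesgue)"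
  proof (rule nn_integral_cmult)
    have [measurable]: "w \<in> borel_measurable lebesgue" by fact
    have [measurable]: "(\<lambda>y. norm (y - c)) \<in> borel_measurable lebesgue"
      by (intro measurable_completion) simp
    have [measurable]: "ball c r \<in> sets lebesgue" by simp
    show "(\<lambda>y. ennreal (indicat_real (- ball c r) y * (w y powr q / norm (y - c) powr N))) \<in> borel_measurable lebesgue"
      by measurable
  qed
  finally show ?thesis .
qed

section \<open>The pointwise effect of truncation\<close>

text \<open>
  Half of the integrand on the left-hand side of the De Giorgi inequality, without the kernel.
\<close>

definition local_gain ::
    "real \<Rightarrow> 'a::euclidean_space set \<Rightarrow> ('a \<Rightarrow> real) \<Rightarrow> ('a \<Rightarrow> real) \<Rightarrow> 'a \<Rightarrow> 'a \<Rightarrow> real" where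
  "local_gain p B w m x y =
     (indicat_real B x * indicat_real B y * \<bar>w x - w y\<bar> powr p
      + indicat_real B x * (w x * m y powr (p - 1))) / 2"

text \<open>
  The error caused by the oscillation of the cutoff \<open>e\<close>, for two points of the large ball \<open>B\<close>. It is
  factored as a weight in \<open>x\<close> times a slice in \<open>y\<close> in order to be integrated with
  \<open>nn_integral_weighted_slices\<close>.
\<close>

definition near_err ::
    "real \<Rightarrow> 'a::euclidean_space set \<Rightarrow> ('a \<Rightarrow> real) \<Rightarrow> ('a \<Rightarrow> real) \<Rightarrow> 'a \<Rightarrow> 'a \<Rightarrow> real" where
  "near_err p B e w x y = (indicat_real B x * w x powr p) * (indicat_real B y * \<bar>e x - e y\<bar> powr p)"

text \<open>
  The error from a point \<open>x\<close> of \<open>B\<close>, a ball containing the support of the cutoff, interacting with a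
  point \<open>y\<close> off the larger ball \<open>B'\<close>.
\<close>

definition far_err ::
    "real \<Rightarrow> 'a::euclidean_space set \<Rightarrow> 'a set \<Rightarrow> ('a \<Rightarrow> real) \<Rightarrow> 'a \<Rightarrow> 'a \<Rightarrow> real" where
  "far_err p B B' w x y = (indicat_real B x * w x) * (indicat_real (- B') y * w y powr (p - 1))"

text \<open>
  The signed quantity \<open>w - m\<close> stands for \<open>u - k\<close> up to sign. The four cases of \<open>w\<close> vanishing or not at \<open>x\<close>
  and \<open>y\<close> correspond to no change, to \<open>truncation_across\<close> in either order, and, if \<open>w\<close> is positive at both points,
  to \<open>truncation_both_above\<close> when they lie in \<open>B\<^sub>2\<close> and to \<open>truncation_far\<close> when one of them leaves it. The inequality is
  not symmetric in \<open>x\<close> and \<open>y\<close> since the mixed term of the gain only counts \<open>x\<close> in \<open>B\<close>.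
\<close>

lemma truncation_pointwise:
  fixes w m e :: "'a::euclidean_space \<Rightarrow> real"
  assumes p: "1 < p" and balls: "B \<subseteq> B\<^sub>1" "B\<^sub>1 \<subseteq> B\<^sub>2"
    and w: "\<And>x. 0 \<le> w x" and m: "\<And>x. 0 \<le> m x" and wm: "\<And>x. w x = 0 \<or> m x = 0"
    and e: "\<And>x. 0 \<le> e x" "\<And>x. e x \<le> 1" "\<And>x. x \<in> B \<Longrightarrow> e x = 1" "\<And>x. x \<notin> B\<^sub>1 \<Longrightarrow> e x = 0"
  shows "\<bar>((1 - e x powr p) * w x - m x) - ((1 - e y powr p) * w y - m y)\<bar> powr p
      + local_gain p B w m x y
    \<le> \<bar>(w x - m x) - (w y - m y)\<bar> powr p
      + (p powr p * (near_err p B\<^sub>2 e w x y + near_err p B\<^sub>2 e w y x)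
         + p * (far_err p B\<^sub>1 B\<^sub>2 w x y + far_err p B\<^sub>1 B\<^sub>2 w y x))"
    (is "?V + _ \<le> ?U + ?E")
proof -
  have ep: "0 \<le> e x powr p" "e x powr p \<le> 1" for x
    using e p by (auto intro: powr_le1)
  have nn: "0 \<le> near_err p B\<^sub>2 e w x y" "0 \<le> far_err p B\<^sub>1 B\<^sub>2 w x y" for x y
    using w by (auto simp: near_err_def far_err_def)
  have E: "0 \<le> ?E"
    using nn[of x y] nn[of y x] p by (intro add_nonneg_nonneg mult_nonneg_nonneg) auto
  define n1 n2 f1 f2 where nf_defs: "n1 = p powr p * near_err p B\<^sub>2 e w x y"
    "n2 = p powr p * near_err p B\<^sub>2 e w y x"
    "f1 = p * far_err p B\<^sub>1 B\<^sub>2 w x y" "f2 = p * far_err p B\<^sub>1 B\<^sub>2 w y x"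
  have E_eq: "?E = n1 + n2 + (f1 + f2)"
    by (simp add: nf_defs distrib_left)
  have nf: "0 \<le> n1" "0 \<le> n2" "0 \<le> f1" "0 \<le> f2"
    using nn[of x y] nn[of y x] p by (auto simp: nf_defs intro!: mult_nonneg_nonneg)
  have ind: "indicat_real B x \<le> e x powr p" for x
    using e(3)[of x] by (auto simp: indicator_def)
  consider "w x = 0" "w y = 0" | "0 < w x" "w y = 0" | "w x = 0" "0 < w y" | "0 < w x" "0 < w y"
    using w[of x] w[of y] by linarith
  then show ?thesis
  proof cases
    case 1
    then show ?thesis using E p by (simp add: local_gain_def)
  next
    case 2
    then have mx: "m x = 0" using wm[of x] by simp
    have g1: "indicat_real B x * indicat_real B y * w x powr p \<le> e x powr p * w x powr p"
      using ind[of x] by (intro mult_right_mono) (auto simp: indicator_def)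
    have g2: "indicat_real B x * (w x * m y powr (p - 1)) \<le> e x powr p * (w x * m y powr (p - 1))"
      using ind[of x] w by (intro mult_right_mono) auto
    have lg: "local_gain p B w m x y = (indicat_real B x * indicat_real B y * w x powr p + indicat_real B x * (w x * m y powr (p - 1))) / 2"
      using 2 by (simp add: local_gain_def)
    have eq: "e x powr p / 2 * (w x powr p + w x * m y powr (p - 1))
        = (e x powr p * w x powr p + e x powr p * (w x * m y powr (p - 1))) / 2"
      by (simp add: distrib_left)
    have "local_gain p B w m x y \<le> e x powr p / 2 * (w x powr p + w x * m y powr (p - 1))"
      unfolding lg eq by (intro divide_right_mono add_mono g1 g2) simp
    moreover have "((1 - e x powr p) * w x + m y) powr p
        + e x powr p / 2 * (w x powr p + w x * m y powr (p - 1)) \<le> (w x + m y) powr p"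
      using p ep w m by (intro truncation_across) auto
    moreover have "\<bar>(1 - e x powr p) * w x + m y\<bar> = (1 - e x powr p) * w x + m y" "\<bar>w x + m y\<bar> = w x + m y"
      using ep[of x] w m by (auto intro!: abs_of_nonneg add_nonneg_nonneg)
    ultimately show ?thesis using E 2 mx by simp
  next
    case 3
    then have my: "m y = 0" using wm[of y] by simp
    have g1: "indicat_real B x * indicat_real B y * w y powr p \<le> e y powr p * w y powr p"
      using ind[of y] by (intro mult_right_mono) (auto simp: indicator_def)
    have g2: "0 \<le> e y powr p * (w y * m x powr (p - 1))"
      using w by auto
    have lg: "local_gain p B w m x y = (indicat_real B x * indicat_real B y * w y powr p + 0) / 2"
      using 3 by (simp add: local_gain_def)
    have eq: "e y powr p / 2 * (w y powr p + w y * m x powr (p - 1))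
        = (e y powr p * w y powr p + e y powr p * (w y * m x powr (p - 1))) / 2"
      by (simp add: distrib_left)
    have "local_gain p B w m x y \<le> e y powr p / 2 * (w y powr p + w y * m x powr (p - 1))"
      unfolding lg eq by (intro divide_right_mono add_mono g1 g2) simp
    moreover have "((1 - e y powr p) * w y + m x) powr p
        + e y powr p / 2 * (w y powr p + w y * m x powr (p - 1)) \<le> (w y + m x) powr p"
      using p ep w m by (intro truncation_across) auto
    moreover have "\<bar>- m x - (1 - e y powr p) * w y\<bar> = (1 - e y powr p) * w y + m x"
      "\<bar>- m x - w y\<bar> = w y + m x"
      using mult_nonneg_nonneg[of "1 - e y powr p" "w y"] ep[of y] w[of y] m[of x] by linarith+
    ultimately show ?thesis using E 3 my by simp
  next
    case 4
    then have mxy: "m x = 0" "m y = 0" using wm[of x] wm[of y] by auto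
    have VU: "?V = \<bar>(1 - e x powr p) * w x - (1 - e y powr p) * w y\<bar> powr p"
      "?U = \<bar>w x - w y\<bar> powr p"
      using mxy by simp_all
    have gain: "local_gain p B w m x y = indicat_real B x * indicat_real B y * \<bar>w x - w y\<bar> powr p / 2"
      using mxy by (simp add: local_gain_def)
    have gain_le: "local_gain p B w m x y \<le> e z powr p * \<bar>w x - w y\<bar> powr p" if "z \<in> {x, y}" for z
    proof -
      have "indicat_real B x * indicat_real B y \<le> e z powr p"
        using that ind[of x] ind[of y] by (auto simp: indicator_def)
      then have "indicat_real B x * indicat_real B y * \<bar>w x - w y\<bar> powr p \<le> e z powr p * \<bar>w x - w y\<bar> powr p"
        by (intro mult_right_mono) auto
      moreover have "0 \<le> indicat_real B x * indicat_real B y * \<bar>w x - w y\<bar> powr p" by simp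
      ultimately show ?thesis unfolding gain by linarith
    qed
    consider "x \<in> B\<^sub>2" "y \<in> B\<^sub>2" | "x \<in> B\<^sub>1" "y \<notin> B\<^sub>2" | "x \<notin> B\<^sub>2" "y \<in> B\<^sub>1" | "x \<notin> B\<^sub>1" "y \<notin> B\<^sub>1"
      using balls by blast
    then show ?thesis
    proof cases
      case 1
      have near: "n1 = p powr p * \<bar>e y - e x\<bar> powr p * w x powr p"
        "n2 = p powr p * \<bar>e x - e y\<bar> powr p * w y powr p"
        using 1 by (auto simp: nf_defs near_err_def abs_minus_commute)
      show ?thesis
      proof (cases "e y \<le> e x")
        case True
        have "\<bar>(1 - e x powr p) * w x - (1 - e y powr p) * w y\<bar> powr p + e x powr p * \<bar>w x - w y\<bar> powr p
            \<le> \<bar>w x - w y\<bar> powr p + n2"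
          unfolding near using p e w True by (intro truncation_both_above) auto
        then show ?thesis
          unfolding E_eq VU using gain_le[of x] nf by simp
      next
        case False
        have "\<bar>(1 - e y powr p) * w y - (1 - e x powr p) * w x\<bar> powr p + e y powr p * \<bar>w y - w x\<bar> powr p
            \<le> \<bar>w y - w x\<bar> powr p + n1"
          unfolding near using p e w False by (intro truncation_both_above) auto
        then show ?thesis
          unfolding E_eq VU using gain_le[of y] nf by (simp add: abs_minus_commute)
      qed
    next
      case 2
      have ey: "e y = 0" and yB: "y \<notin> B" using 2 e(4)[of y] balls by auto
      have "e x powr p * w x * w y powr (p - 1) \<le> 1 * w x * w y powr (p - 1)"
        using ep w by (intro mult_right_mono) auto
      then have "p * (e x powr p * w x * w y powr (p - 1)) \<le> f1"
        using 2 p by (simp add: nf_defs far_err_def)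
      moreover have "\<bar>(1 - e x powr p) * w x - w y\<bar> powr p
          \<le> \<bar>w x - w y\<bar> powr p + p * (e x powr p * w x * w y powr (p - 1))"
        using p ep w by (intro truncation_far) auto
      ultimately show ?thesis
        unfolding E_eq VU gain using nf yB p by (simp add: ey)
    next
      case 3
      have ex: "e x = 0" and xB: "x \<notin> B" using 3 e(4)[of x] balls by auto
      have "e y powr p * w y * w x powr (p - 1) \<le> 1 * w y * w x powr (p - 1)"
        using ep w by (intro mult_right_mono) auto
      then have "p * (e y powr p * w y * w x powr (p - 1)) \<le> f2"
        using 3 p by (simp add: nf_defs far_err_def)
      moreover have "\<bar>(1 - e y powr p) * w y - w x\<bar> powr p
          \<le> \<bar>w y - w x\<bar> powr p + p * (e y powr p * w y * w x powr (p - 1))"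
        using p ep w by (intro truncation_far) auto
      ultimately show ?thesis
        unfolding E_eq VU gain using nf xB p by (simp add: ex abs_minus_commute)
    next
      case 4
      then have "e x = 0" "e y = 0" "x \<notin> B" using e(4) balls by auto
      then show ?thesis using E p by (simp add: gain mxy)
    qed
  qed
qed

section \<open>Positive and negative parts\<close>

lemma part_nonneg: "0 \<le> part \<sigma> v"
  by (cases \<sigma>) auto

lemma part_flip_disjoint: "part \<sigma> v = 0 \<or> part (flip \<sigma>) v = 0"
  by (cases \<sigma>) auto

lemma part_le_abs: "part \<sigma> v \<le> \<bar>v\<bar>"
  by (cases \<sigma>) auto

lemma borel_measurable_part:
  "f \<in> borel_measurable M \<Longrightarrow> (\<lambda>x. part \<sigma> (f x)) \<in> borel_measurable M"
  by (cases \<sigma>) auto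

lemma borel_measurable_part_level [measurable]:
  "u \<in> borel_measurable M \<Longrightarrow> (\<lambda>x. part \<sigma> (u x - k)) \<in> borel_measurable M"
  by (rule borel_measurable_part) auto

definition sgn2_value :: "sgn2 \<Rightarrow> real" where
  "sgn2_value \<sigma> = (if \<sigma> = Plus then 1 else - 1)"

lemma abs_sgn2_value [simp]: "\<bar>sgn2_value \<sigma>\<bar> = 1"
  by (simp add: sgn2_value_def)

lemma sgn2_value_part_diff: "sgn2_value \<sigma> * (part \<sigma> v - part (flip \<sigma>) v) = v"
  by (cases \<sigma>) (auto simp: sgn2_value_def)

lemma level_set_eq: "level_set \<sigma> u k x R = {y \<in> ball x R. part \<sigma> (u y - k) \<noteq> 0}"
  by (cases \<sigma>) (auto simp: max_def)

section \<open>Finiteness of norms and tails\<close>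

lemma ball_subset_of_infdist_frontier:
  fixes \<Omega> :: "'a::euclidean_space set"
  assumes x: "x \<in> \<Omega>" and R: "R < infdist x (frontier \<Omega>)"
  shows "ball x R \<subseteq> \<Omega>"
proof (rule ccontr)
  assume "\<not> ball x R \<subseteq> \<Omega>"
  then obtain z where z: "z \<in> ball x R" "z \<notin> \<Omega>" by blast
  then have "0 < R" by (auto intro: le_less_trans[OF zero_le_dist])
  then have "ball x R \<inter> frontier \<Omega> \<noteq> {}"
  proof (intro connected_Int_frontier)
    have "x \<in> ball x R \<inter> \<Omega>" using x \<open>0 < R\<close> by simp
    then show "ball x R \<inter> \<Omega> \<noteq> {}" by blast
  qed (use z in auto)
  then obtain y where y: "dist x y < R" "y \<in> frontier \<Omega>" by auto
  with R show False using infdist_le[of y "frontier \<Omega>" x] by simp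
qed

lemma powr_add_le:
  fixes a b q :: real
  assumes "0 \<le> a" "0 \<le> b" "0 < q"
  shows "(a + b) powr q \<le> 2 powr q * (a powr q + b powr q)"
proof -
  have "(a + b) powr q \<le> (2 * max a b) powr q"
    using assms by (intro powr_mono2) auto
  also have "\<dots> = 2 powr q * max a b powr q"
    using assms by (simp add: powr_mult)
  also have "\<dots> \<le> 2 powr q * (a powr q + b powr q)"
    by (intro mult_left_mono) (auto simp: max_def)
  finally show ?thesis .
qed

text \<open>
  The part is bounded by \<open>\<bar>u\<bar> + \<bar>k\<bar>\<close>. The contribution of \<open>u\<close> is finite by the definition of the tail space,
  because \<open>1 + norm x\<close> is at most a multiple of \<open>norm (x - c)\<close> off the ball; the contribution of the constant
  is finite by \<open>nn_integral_kernel_outside_ball_finite\<close>. Integrability matters because the Bochner integral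
  in the definition of the tail would otherwise be \<open>0\<close>.
\<close>

lemma integrable_tail:
  fixes u :: "real ^ 'n \<Rightarrow> real" and s p :: real
  assumes s: "0 < s" and p: "1 < p" and u: "u \<in> tail_space s p" and r: "0 < r"
  shows "integrable (lebesgue_on (- ball c r))
    (\<lambda>x. \<bar>part \<sigma> (u x - k)\<bar> powr (p - 1) / norm (x - c) powr (real CARD('n) + s * p))"
    (is "integrable ?M ?f")
proof (rule integrableI_nonneg)
  let ?N = "real CARD('n) + s * p"
  have [measurable]: "u \<in> borel_measurable lebesgue"
    using u by (simp add: tail_space_def)
  have N: "0 \<le> ?N" using s p by simp
  have [measurable]: "(\<lambda>y. norm (y - c)) \<in> borel_measurable lebesgue" for c :: "real ^ 'n"
    by (intro measurable_completion) simp
  have [measurable]: "(\<lambda>y. norm y) \<in> borel_measurable (lebesgue :: (real ^ 'n) measure)"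
    by (intro measurable_completion) simp
  have [measurable]: "ball c r \<in> sets lebesgue" by simp
  have fm: "?f \<in> borel_measurable lebesgue" by measurable
  show "?f \<in> borel_measurable ?M"
    using fm by (rule measurable_restrict_space1)
  show "AE x in ?M. 0 \<le> ?f x" by simp
  \<comment> \<open>The constant with \<open>1 + norm x \<le> B * norm (x - c)\<close> off the ball of radius \<open>r\<close> around \<open>c\<close>.\<close>
  define B where "B = (1 + r + norm c) / r"
  define g where "g x = \<bar>u x\<bar> powr (p - 1) / (1 + norm x) powr ?N" for x
  define h where "h x = indicat_real (- ball c r) x / norm (x - c) powr ?N" for x
  have [measurable]: "g \<in> borel_measurable lebesgue" "h \<in> borel_measurable lebesgue"
    unfolding g_def[abs_def] h_def[abs_def] by measurable
  have gh: "0 \<le> g x" "0 \<le> h x" for x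
    by (simp_all add: g_def h_def)
  have le: "indicat_real (- ball c r) x * ?f x
      \<le> 2 powr (p - 1) * B powr ?N * g x + 2 powr (p - 1) * \<bar>k\<bar> powr (p - 1) * h x" for x
  proof (cases "x \<in> ball c r")
    case True
    then show ?thesis by (simp add: g_def h_def)
  next
    case False
    define D where "D = norm (x - c)"
    have D: "r \<le> D" using False by (simp add: D_def dist_norm norm_minus_commute)
    have "1 + norm x \<le> 1 + norm c + D"
      using norm_triangle_ineq[of "x - c" c] by (simp add: D_def)
    also have "\<dots> \<le> B * D"
    proof -
      have "(1 + norm c) * r \<le> (1 + norm c) * D"
        using D by (intro mult_left_mono) auto
      then show ?thesis using r by (simp add: B_def field_simps)
    qed
    finally have "(1 + norm x) powr ?N \<le> (B * D) powr ?N"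
      using N by (intro powr_mono2) auto
    also have "\<dots> = B powr ?N * D powr ?N"
      using r D by (subst powr_mult) (auto simp: B_def)
    finally have XBD: "(1 + norm x) powr ?N \<le> B powr ?N * D powr ?N" .
    have 1: "1 / D powr ?N \<le> B powr ?N / (1 + norm x) powr ?N"
    proof -
      have "0 < D powr ?N" using r D by simp
      moreover have "0 < (1 + norm x) powr ?N"
        using add_pos_nonneg[OF zero_less_one norm_ge_zero[of x]] by simp
      ultimately show ?thesis
        using XBD
        by (simp add: pos_le_divide_eq pos_divide_le_eq)
    qed
    have "\<bar>part \<sigma> (u x - k)\<bar> powr (p - 1) \<le> (\<bar>u x\<bar> + \<bar>k\<bar>) powr (p - 1)"
      using p part_le_abs[of \<sigma> "u x - k"] part_nonneg[of \<sigma> "u x - k"] by (intro powr_mono2) auto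
    also have "\<dots> \<le> 2 powr (p - 1) * (\<bar>u x\<bar> powr (p - 1) + \<bar>k\<bar> powr (p - 1))"
      using p by (intro powr_add_le) auto
    finally have "\<bar>part \<sigma> (u x - k)\<bar> powr (p - 1) / D powr ?N
        \<le> 2 powr (p - 1) * (\<bar>u x\<bar> powr (p - 1) + \<bar>k\<bar> powr (p - 1)) / D powr ?N"
      by (rule divide_right_mono) simp
    also have "\<dots> = 2 powr (p - 1) * \<bar>u x\<bar> powr (p - 1) * (1 / D powr ?N)
        + 2 powr (p - 1) * \<bar>k\<bar> powr (p - 1) * (1 / D powr ?N)"
      by (simp add: distrib_left add_divide_distrib)
    also have "2 powr (p - 1) * \<bar>u x\<bar> powr (p - 1) * (1 / D powr ?N)
        \<le> 2 powr (p - 1) * \<bar>u x\<bar> powr (p - 1) * (B powr ?N / (1 + norm x) powr ?N)"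
      by (intro mult_left_mono 1) auto
    finally show ?thesis using False by (simp add: g_def h_def D_def mult_ac)
  qed
  have "(\<integral>\<^sup>+x. ennreal (?f x) \<partial>?M) = (\<integral>\<^sup>+x. ennreal (indicat_real (- ball c r) x * ?f x) \<partial>lebesgue)"
    by (subst nn_integral_restrict_space) (auto intro!: nn_integral_cong simp: indicator_def)
  also have "\<dots> \<le> (\<integral>\<^sup>+x. ennreal (2 powr (p - 1) * B powr ?N * g x + 2 powr (p - 1) * \<bar>k\<bar> powr (p - 1) * h x) \<partial>lebesgue)"
    by (intro nn_integral_mono ennreal_leI le)
  also have "\<dots> = (\<integral>\<^sup>+x. ennreal (2 powr (p - 1) * B powr ?N) * ennreal (g x)
      + ennreal (2 powr (p - 1) * \<bar>k\<bar> powr (p - 1)) * ennreal (h x) \<partial>lebesgue)"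
    using gh by (intro nn_integral_cong) (simp add: ennreal_mult')
  also have "\<dots> = ennreal (2 powr (p - 1) * B powr ?N) * (\<integral>\<^sup>+x. ennreal (g x) \<partial>lebesgue)
      + ennreal (2 powr (p - 1) * \<bar>k\<bar> powr (p - 1)) * (\<integral>\<^sup>+x. ennreal (h x) \<partial>lebesgue)"
    by (simp add: nn_integral_add nn_integral_cmult)
  also have "\<dots> < \<infinity>"
  proof -
    have "(\<integral>\<^sup>+x. ennreal (g x) \<partial>lebesgue) < \<infinity>"
      using u unfolding g_def tail_space_def mem_Collect_eq by (rule conjunct2)
    moreover have "(\<integral>\<^sup>+x. ennreal (h x) \<partial>lebesgue) < \<infinity>"
      unfolding h_def using nn_integral_kernel_outside_ball_finite[of "s * p" r c] s p r
      by (simp only: DIM_cart DIM_real mult_1_right) simp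
    ultimately show ?thesis by (simp add: ennreal_mult_less_top)
  qed
  finally show "(\<integral>\<^sup>+x. ennreal (?f x) \<partial>?M) < \<infinity>" .
qed

lemma Tail_powr_eq_nn_integral:
  fixes u :: "real ^ 'n \<Rightarrow> real" and s p :: real
  assumes s: "0 < s" and p: "1 < p" and u: "u \<in> tail_space s p" and r: "0 < r"
  shows "ennreal (Tail s p (\<lambda>x. part \<sigma> (u x - k)) c r powr (p - 1))
    = (\<integral>\<^sup>+x. ennreal (indicat_real (- ball c r) x
        * (part \<sigma> (u x - k) powr (p - 1) / norm (x - c) powr (real CARD('n) + s * p))) \<partial>lebesgue)"
proof -
  let ?f = "\<lambda>x. \<bar>part \<sigma> (u x - k)\<bar> powr (p - 1) / norm (x - c) powr (real CARD('n) + s * p)"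
  have "Tail s p (\<lambda>x. part \<sigma> (u x - k)) c r powr (p - 1) = (\<integral>x. ?f x \<partial>lebesgue_on (- ball c r))"
    using p by (simp add: Tail_def powr_powr Bochner_Integration.integral_nonneg)
  also have "ennreal \<dots> = (\<integral>\<^sup>+x. ennreal (?f x) \<partial>lebesgue_on (- ball c r))"
    using integrable_tail[OF assms] by (intro nn_integral_eq_integral[symmetric]) auto
  also have "\<dots> = (\<integral>\<^sup>+x. ennreal (indicat_real (- ball c r) x
        * (part \<sigma> (u x - k) powr (p - 1) / norm (x - c) powr (real CARD('n) + s * p))) \<partial>lebesgue)"
    by (subst nn_integral_restrict_space)
      (simp, intro nn_integral_cong, simp add: indicator_def part_nonneg)
  finally show ?thesis .
qed

text \<open>
  Used for \<open>q = p\<close> and \<open>q = 1\<close>. As for the tail, the point is that the Bochner integral in the norm is a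
  genuine one.
\<close>

lemma Lp_norm_powr_eq_nn_integral:
  fixes u :: "real ^ 'n \<Rightarrow> real" and p q :: real
  assumes um: "u \<in> borel_measurable lebesgue" and u: "in_Lp p \<Omega> u" and B: "ball c R \<subseteq> \<Omega>" "\<Omega> \<in> sets lebesgue"
    and q: "1 \<le> q" "q \<le> p"
  shows "ennreal (Lp_norm q (ball c R) (\<lambda>x. part \<sigma> (u x - k)) powr q)
    = (\<integral>\<^sup>+x. ennreal (indicat_real (ball c R) x * part \<sigma> (u x - k) powr q) \<partial>lebesgue)"
proof -
  let ?M = "lebesgue_on (ball c R)"
  let ?f = "\<lambda>x. \<bar>part \<sigma> (u x - k)\<bar> powr q"
  note [measurable] = um
  have int: "integrable ?M ?f"
  proof (rule Bochner_Integration.integrable_bound)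
    have "integrable ?M (\<lambda>x. \<bar>u x\<bar> powr p)"
    proof -
      have "set_integrable lebesgue \<Omega> (\<lambda>x. \<bar>u x\<bar> powr p)"
        using u B by (simp add: in_Lp_def set_integrable_def integrable_restrict_space)
      then have "set_integrable lebesgue (ball c R) (\<lambda>x. \<bar>u x\<bar> powr p)"
        by (rule set_integrable_subset) (use B in auto)
      then show ?thesis
        by (simp add: set_integrable_def integrable_restrict_space)
    qed
    moreover have "integrable ?M (\<lambda>x. d)" for d :: real
      by (intro finite_measure.integrable_const finite_measure_lebesgue_on lmeasurable_ball)
    ultimately show "integrable ?M (\<lambda>x. 2 powr p * \<bar>u x\<bar> powr p + 2 powr p * (1 + \<bar>k\<bar> powr p))"
      by (intro Bochner_Integration.integrable_add integrable_mult_right) auto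
    have "?f \<in> borel_measurable lebesgue" by measurable
    then show "?f \<in> borel_measurable ?M" by (rule measurable_restrict_space1)
    have bound: "?f x \<le> 2 powr p * \<bar>u x\<bar> powr p + 2 powr p * (1 + \<bar>k\<bar> powr p)" for x
    proof -
      define a where "a = \<bar>part \<sigma> (u x - k)\<bar>"
      have a: "0 \<le> a" "a \<le> \<bar>u x\<bar> + \<bar>k\<bar>"
        using part_le_abs[of \<sigma> "u x - k"] part_nonneg[of \<sigma> "u x - k"] by (auto simp: a_def)
      have "a powr q \<le> 1 + a powr p"
      proof (cases "a \<le> 1")
        case True
        then have "a powr q \<le> 1" using a q by (auto intro: powr_le1)
        then show ?thesis using powr_ge_zero[of a p] by linarith
      next
        case False
        then show ?thesis using q powr_mono[of q p a] by linarith
      qed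
      moreover have "a powr p \<le> (\<bar>u x\<bar> + \<bar>k\<bar>) powr p"
        using a q by (intro powr_mono2) auto
      moreover have "\<dots> \<le> 2 powr p * (\<bar>u x\<bar> powr p + \<bar>k\<bar> powr p)"
        using q by (intro powr_add_le) auto
      moreover have "1 \<le> (2::real) powr p" using q by (simp add: ge_one_powr_ge_zero)
      ultimately show ?thesis by (simp add: distrib_left flip: a_def)
    qed
    show "AE x in ?M. norm (?f x) \<le> norm (2 powr p * \<bar>u x\<bar> powr p + 2 powr p * (1 + \<bar>k\<bar> powr p))"
    proof (rule AE_I2)
      fix x
      have "norm (?f x) = ?f x" by simp
      also note bound[of x]
      also have "2 powr p * \<bar>u x\<bar> powr p + 2 powr p * (1 + \<bar>k\<bar> powr p)
          \<le> norm (2 powr p * \<bar>u x\<bar> powr p + 2 powr p * (1 + \<bar>k\<bar> powr p))"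
        by simp
      finally show "norm (?f x) \<le> norm (2 powr p * \<bar>u x\<bar> powr p + 2 powr p * (1 + \<bar>k\<bar> powr p))" .
    qed
  qed
  have "Lp_norm q (ball c R) (\<lambda>x. part \<sigma> (u x - k)) powr q = (\<integral>x. ?f x \<partial>?M)"
    using q by (simp add: Lp_norm_def powr_powr Bochner_Integration.integral_nonneg)
  also have "ennreal \<dots> = (\<integral>\<^sup>+x. ennreal (?f x) \<partial>?M)"
    using int by (intro nn_integral_eq_integral[symmetric]) auto
  also have "\<dots> = (\<integral>\<^sup>+x. ennreal (indicat_real (ball c R) x * part \<sigma> (u x - k) powr q) \<partial>lebesgue)"
    by (subst nn_integral_restrict_space)
      (auto intro!: nn_integral_cong simp: indicator_def part_nonneg)
  finally show ?thesis .
qed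

lemma C_dom_sets:
  assumes "open (\<Omega> :: (real ^ 'n) set)"
  shows "C_dom \<Omega> \<in> sets lebesgue"
proof -
  have "closed ((- \<Omega>) \<times> (- \<Omega>))"
    using assms by (intro closed_Times) (auto simp: closed_def)
  then have "open (C_dom \<Omega>)"
    by (simp add: C_dom_def open_Compl)
  then show ?thesis by simp
qed

text \<open>
  The square of \<open>\<Omega>\<close> is part of \<open>C_dom \<Omega>\<close>.
\<close>

lemma frac_sobolev_of_energy_space:
  fixes u :: "real ^ 'n \<Rightarrow> real"
  assumes \<Omega>: "open \<Omega>" and u: "u \<in> energy_space s p \<Omega>"
  shows "u \<in> frac_sobolev s p \<Omega>"
proof -
  let ?N = "real CARD('n) + s * p"
  have um: "u \<in> borel_measurable lebesgue" and Lp: "in_Lp p \<Omega> u"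
    and fin: "(\<integral>\<^sup>+(x, y). ennreal (\<bar>u x - u y\<bar> powr p / norm (x - y) powr ?N) \<partial>lebesgue_on (C_dom \<Omega>)) < \<infinity>"
    using u by (auto simp: energy_space_def)
  note [measurable] = borel_measurable_lebesgue_fst[OF um] borel_measurable_lebesgue_snd[OF um]
    borel_measurable_norm_diff_lebesgue
  have om: "\<Omega> \<in> sets lebesgue" using \<Omega> by auto
  have "indicat_real \<Omega> \<in> borel_measurable lebesgue" using om by simp
  note [measurable] = borel_measurable_lebesgue_fst[OF this] borel_measurable_lebesgue_snd[OF this]
  let ?f = "\<lambda>z. ennreal (indicat_real \<Omega> (snd z) * (indicat_real \<Omega> (fst z)
      * (\<bar>u (fst z) - u (snd z)\<bar> powr p / norm (fst z - snd z) powr ?N)))"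
  have fm: "?f \<in> borel_measurable lebesgue" by measurable
  have "gagliardo_pow s p \<Omega> u = (\<integral>\<^sup>+y. (\<integral>\<^sup>+x. ?f (x, y) \<partial>lebesgue) \<partial>lebesgue)"
    unfolding gagliardo_pow_def using om
    by (simp add: nn_integral_restrict_space) (auto intro!: nn_integral_cong simp: indicator_def)
  also have "\<dots> = (\<integral>\<^sup>+z. ?f z \<partial>lebesgue)"
    using nn_integral_lebesgue_iterated(2)[OF fm] by simp
  also have "\<dots> \<le> (\<integral>\<^sup>+(x, y). ennreal (\<bar>u x - u y\<bar> powr p / norm (x - y) powr ?N) \<partial>lebesgue_on (C_dom \<Omega>))"
    using C_dom_sets[OF \<Omega>]
    by (subst nn_integral_restrict_space)
      (auto intro!: nn_integral_mono simp: indicator_def C_dom_def split: prod.splits)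
  also note fin
  finally show ?thesis using Lp by (simp add: frac_sobolev_def)
qed

section \<open>Consequences of comparing energies\<close>

text \<open>
  Approximate \<open>u\<close> by simple functions: along these the composition is a finite sum of measurable functions,
  and it converges at almost every point by continuity of \<open>F\<close> in the second variable.
\<close>

lemma borel_measurable_caratheodory:
  fixes \<Omega> :: "(real ^ 'n) set"
  assumes \<Omega>: "\<Omega> \<in> sets lebesgue" and F: "caratheodory_on \<Omega> F"
    and u: "u \<in> borel_measurable (lebesgue_on \<Omega>)"
  shows "(\<lambda>x. F x (u x)) \<in> borel_measurable (lebesgue_on \<Omega>)"
proof -
  obtain S where S: "\<And>i. simple_function (lebesgue_on \<Omega>) (S i)"
    "\<And>x. x \<in> \<Omega> \<Longrightarrow> (\<lambda>i. S i x) \<longlonglongrightarrow> u x"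
    using borel_measurable_implies_sequence_metric[OF u, of 0] by auto
  define G where "G i x = (\<Sum>t\<in>S i ` \<Omega>. indicator (S i -` {t} \<inter> \<Omega>) x * F x t)" for i x
  have fin: "finite (S i ` \<Omega>)" for i
    using simple_functionD(1)[OF S(1)[of i]] by simp
  have G: "G i x = F x (S i x)" if "x \<in> \<Omega>" for i x
  proof -
    have "G i x = (\<Sum>t\<in>S i ` \<Omega>. if t = S i x then F x t else 0)"
      unfolding G_def using that by (intro sum.cong) (auto simp: indicator_def)
    then show ?thesis using that fin by simp
  qed
  have Gm: "G i \<in> borel_measurable (lebesgue_on \<Omega>)" for i
    unfolding G_def
    using simple_functionD(2)[OF S(1)[of i]] F
    by (intro borel_measurable_sum borel_measurable_times borel_measurable_indicator)
      (auto simp: caratheodory_on_def)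
  have "AE x in lebesgue_on \<Omega>. (\<lambda>i. G i x) \<longlonglongrightarrow> F x (u x)"
  proof -
    have "AE x in lebesgue_on \<Omega>. continuous_on UNIV (F x)"
      using F by (simp add: caratheodory_on_def)
    moreover have "AE x in lebesgue_on \<Omega>. x \<in> \<Omega>"
      using AE_space[of "lebesgue_on \<Omega>"] by (simp add: space_restrict_space)
    ultimately show ?thesis
    proof eventually_elim
      case (elim x)
      then have "(\<lambda>i. F x (S i x)) \<longlonglongrightarrow> F x (u x)"
        using S(2) by (intro isCont_tendsto_compose[of _ "F x"])
          (auto simp: continuous_on_eq_continuous_at)
      then show ?case using elim by (simp add: G)
    qed
  qed
  then have ae: "AE x in lebesgue. lim (\<lambda>i. indicat_real \<Omega> x * G i x) = indicat_real \<Omega> x * F x (u x)"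
    using \<Omega> by (auto simp: AE_restrict_space_iff indicator_def elim!: eventually_mono intro!: limI)
  have "(\<lambda>x. indicat_real \<Omega> x * G i x) \<in> borel_measurable lebesgue" for i
    using Gm[of i] \<Omega> by (simp add: borel_measurable_restrict_space_iff)
  then have "(\<lambda>x. lim (\<lambda>i. indicat_real \<Omega> x * G i x)) \<in> borel_measurable lebesgue"
    by (rule borel_measurable_lim_metric)
  from borel_measurable_AE[OF this ae] show ?thesis
    using \<Omega> by (simp add: borel_measurable_restrict_space_iff)
qed

lemma potential_difference_le:
  fixes \<Omega> :: "(real ^ 'n) set" and u v :: "real ^ 'n \<Rightarrow> real"
  assumes \<Omega>: "open \<Omega>" "bounded \<Omega>" and F: "caratheodory_on \<Omega> F"
    and F0: "AE x in lebesgue_on \<Omega>. \<forall>t. \<bar>F x t\<bar> \<le> F\<^sub>0"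
    and u: "u \<in> borel_measurable lebesgue" and v: "v \<in> borel_measurable lebesgue"
    and A: "A \<in> sets lebesgue" "A \<subseteq> \<Omega>" and eq: "\<And>x. x \<notin> A \<Longrightarrow> v x = u x"
  shows "(\<integral>x. F x (v x) \<partial>lebesgue_on \<Omega>) - (\<integral>x. F x (u x) \<partial>lebesgue_on \<Omega>) \<le> 2 * F\<^sub>0 * measure lebesgue A"
proof -
  let ?M = "lebesgue_on \<Omega>"
  have om: "\<Omega> \<in> lmeasurable" using \<Omega> by (intro lmeasurable_open)
  then have oms: "\<Omega> \<in> sets lebesgue" by auto
  interpret finite_measure ?M
    using om by (rule finite_measure_lebesgue_on)
  have int: "integrable ?M (\<lambda>x. F x (g x))" if g: "g \<in> borel_measurable lebesgue" for g
  proof (rule integrable_const_bound)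
    show "AE x in ?M. norm (F x (g x)) \<le> F\<^sub>0"
      using F0 by eventually_elim simp
    show "(\<lambda>x. F x (g x)) \<in> borel_measurable ?M"
      using oms F measurable_restrict_space1[OF g] by (rule borel_measurable_caratheodory)
  qed
  have AM: "A \<in> sets ?M" using A oms by (auto simp: sets_restrict_space_iff)
  have "(\<integral>x. F x (v x) \<partial>?M) - (\<integral>x. F x (u x) \<partial>?M) = (\<integral>x. F x (v x) - F x (u x) \<partial>?M)"
    using int u v by (intro Bochner_Integration.integral_diff[symmetric]) auto
  also have "\<dots> \<le> (\<integral>x. 2 * F\<^sub>0 * indicat_real A x \<partial>?M)"
  proof (rule integral_mono_AE)
    show "integrable ?M (\<lambda>x. F x (v x) - F x (u x))" using int u v by auto
    show "integrable ?M (\<lambda>x. 2 * F\<^sub>0 * indicat_real A x)"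
      using AM by (intro integrable_mult_right integrable_real_indicator) (auto simp: less_top[symmetric])
    show "AE x in ?M. F x (v x) - F x (u x) \<le> 2 * F\<^sub>0 * indicat_real A x"
      using F0
    proof eventually_elim
      case (elim x)
      show ?case
      proof (cases "x \<in> A")
        case True
        then show ?thesis using elim[rule_format, of "v x"] elim[rule_format, of "u x"] by simp
      qed (simp add: eq)
    qed
  qed
  also have "\<dots> = 2 * F\<^sub>0 * measure lebesgue A"
    using A oms AM by (simp add: measure_restrict_space Int_absorb2)
  finally show ?thesis .
qed

text \<open>
  The nonlocal part of the energy of \<open>v\<close> may be infinite, so the comparison is stated in \<open>[0, \<infinity>]\<close>
  with everything else on the right-hand side.
\<close>

lemma energy_le_imp_nonlocal_le:
  fixes u v :: "real ^ 'n \<Rightarrow> real"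
  assumes p: "0 < p" and le: "energy p K F \<Omega> u \<le> energy p K F \<Omega> v"
    and fin: "(\<integral>\<^sup>+(x, y). ennreal (\<bar>u x - u y\<bar> powr p * K x y) \<partial>lebesgue_on (C_dom \<Omega>)) < \<infinity>"
    and D: "(\<integral>x. F x (v x) \<partial>lebesgue_on \<Omega>) - (\<integral>x. F x (u x) \<partial>lebesgue_on \<Omega>) \<le> D" "0 \<le> D"
  shows "(\<integral>\<^sup>+(x, y). ennreal (\<bar>u x - u y\<bar> powr p * K x y) \<partial>lebesgue_on (C_dom \<Omega>))
    \<le> (\<integral>\<^sup>+(x, y). ennreal (\<bar>v x - v y\<bar> powr p * K x y) \<partial>lebesgue_on (C_dom \<Omega>)) + ennreal (2 * p * D)"
    (is "?U \<le> ?V + _")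
proof (cases "?V = \<infinity>")
  case False
  obtain U where U: "?U = ennreal U" "0 \<le> U" using fin by (cases ?U) auto
  obtain V where V: "?V = ennreal V" "0 \<le> V" using False by (cases ?V) auto
  have "1 / (2 * p) * U + (\<integral>x. F x (u x) \<partial>lebesgue_on \<Omega>) \<le> 1 / (2 * p) * V + (\<integral>x. F x (v x) \<partial>lebesgue_on \<Omega>)"
    using le unfolding energy_def U(1) V(1) using U V by simp
  then have "1 / (2 * p) * U \<le> 1 / (2 * p) * V + D" using D by linarith
  then have "2 * p * (1 / (2 * p) * U) \<le> 2 * p * (1 / (2 * p) * V + D)"
    using p by (intro mult_left_mono) auto
  then have "U \<le> V + 2 * p * D" using p by (simp add: distrib_left)
  then show ?thesis
    unfolding U V using V p D by (simp add: ennreal_plus[symmetric] ennreal_leI del: ennreal_plus)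
qed simp

section \<open>Integrated gain and error\<close>

text \<open>
  Tonelli's theorem, in both orders: the seminorm is defined with the outer integral in \<open>y\<close>, the mixed term
  with the outer integral in \<open>x\<close>.
\<close>

lemma nn_integral_local_gain:
  fixes u :: "real ^ 'n \<Rightarrow> real" and c :: "real ^ 'n" and s p k r :: real
  assumes um: "u \<in> borel_measurable lebesgue"
  defines "N \<equiv> real CARD('n) + s * p"
  shows "gagliardo_pow s p (ball c r) (\<lambda>x. part \<sigma> (u x - k))
      + (\<integral>\<^sup>+x. ennreal (part \<sigma> (u x - k)) *
           (\<integral>\<^sup>+y. ennreal (part (flip \<sigma>) (u y - k) powr (p - 1) / norm (x - y) powr N) \<partial>lebesgue)
           \<partial>lebesgue_on (ball c r))
    = (\<integral>\<^sup>+z. ennreal (2 * (local_gain p (ball c r) (\<lambda>x. part \<sigma> (u x - k)) (\<lambda>x. part (flip \<sigma>) (u x - k))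
          (fst z) (snd z) / norm (fst z - snd z) powr N)) \<partial>lebesgue)"
proof -
  define w where "w x = part \<sigma> (u x - k)" for x
  define m where "m x = part (flip \<sigma>) (u x - k)" for x
  have w0: "0 \<le> w x" and m0: "0 \<le> m x" for x
    by (simp_all add: w_def m_def part_nonneg)
  have wm: "w \<in> borel_measurable lebesgue" and mm: "m \<in> borel_measurable lebesgue"
    using um unfolding w_def[abs_def] m_def[abs_def] by measurable
  have im: "indicat_real (ball c r) \<in> borel_measurable lebesgue"
    by (intro borel_measurable_indicator) auto
  note [measurable] = borel_measurable_lebesgue_fst[OF wm] borel_measurable_lebesgue_snd[OF wm]
    borel_measurable_lebesgue_snd[OF mm] borel_measurable_norm_diff_lebesgue
    borel_measurable_lebesgue_fst[OF im] borel_measurable_lebesgue_snd[OF im]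
  let ?I = "indicat_real (ball c r)"
  let ?g1 = "\<lambda>z. ennreal (?I (fst z) * ?I (snd z) * \<bar>w (fst z) - w (snd z)\<bar> powr p / norm (fst z - snd z) powr N)"
  let ?g2 = "\<lambda>z. ennreal (?I (fst z) * (w (fst z) * m (snd z) powr (p - 1)) / norm (fst z - snd z) powr N)"
  have g1: "?g1 \<in> borel_measurable lebesgue" by measurable
  have g2: "?g2 \<in> borel_measurable lebesgue" by measurable
  have "gagliardo_pow s p (ball c r) w = (\<integral>\<^sup>+y. (\<integral>\<^sup>+x. ?g1 (x, y) \<partial>lebesgue) \<partial>lebesgue)"
    unfolding gagliardo_pow_def N_def
    by (simp add: nn_integral_restrict_space) (auto intro!: nn_integral_cong simp: indicator_def)
  then have 1: "gagliardo_pow s p (ball c r) w = (\<integral>\<^sup>+z. ?g1 z \<partial>lebesgue)"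
    using nn_integral_lebesgue_iterated(2)[OF g1] by simp
  have nm: "(\<lambda>y. norm (x - y)) \<in> borel_measurable lebesgue" for x :: "real ^ 'n"
    by (intro measurable_completion) simp
  have inner: "ennreal (w x) * (\<integral>\<^sup>+y. ennreal (m y powr (p - 1) / norm (x - y) powr N) \<partial>lebesgue) * indicator (ball c r) x
      = (\<integral>\<^sup>+y. ?g2 (x, y) \<partial>lebesgue)" for x
  proof (cases "x \<in> ball c r")
    case True
    note [measurable] = mm nm
    have "(\<lambda>y. ennreal (m y powr (p - 1) / norm (x - y) powr N)) \<in> borel_measurable lebesgue"
      by measurable
    from nn_integral_cmult[OF this, of "ennreal (w x)"] show ?thesis
      using True w0 m0 by (simp add: ennreal_mult'[symmetric])
  qed simp
  have "(\<integral>\<^sup>+x. ennreal (w x) * (\<integral>\<^sup>+y. ennreal (m y powr (p - 1) / norm (x - y) powr N) \<partial>lebesgue) \<partial>lebesgue_on (ball c r))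
      = (\<integral>\<^sup>+x. (\<integral>\<^sup>+y. ?g2 (x, y) \<partial>lebesgue) \<partial>lebesgue)"
    by (subst nn_integral_restrict_space) (simp_all only: inner, simp)
  then have 2: "(\<integral>\<^sup>+x. ennreal (w x) * (\<integral>\<^sup>+y. ennreal (m y powr (p - 1) / norm (x - y) powr N) \<partial>lebesgue) \<partial>lebesgue_on (ball c r))
      = (\<integral>\<^sup>+z. ?g2 z \<partial>lebesgue)"
    using nn_integral_lebesgue_iterated(1)[OF g2] by simp
  have "(\<integral>\<^sup>+z. ?g1 z \<partial>lebesgue) + (\<integral>\<^sup>+z. ?g2 z \<partial>lebesgue) = (\<integral>\<^sup>+z. ?g1 z + ?g2 z \<partial>lebesgue)"
    using g1 g2 by (rule nn_integral_add[symmetric])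
  also have "\<dots> = (\<integral>\<^sup>+z. ennreal (2 * (local_gain p (ball c r) w m (fst z) (snd z) / norm (fst z - snd z) powr N)) \<partial>lebesgue)"
    by (intro nn_integral_cong, subst ennreal_plus[symmetric])
      (auto simp: local_gain_def w0 m0 add_divide_distrib)
  finally show ?thesis
    using 1 2 by (simp add: w_def[abs_def] m_def[abs_def])
qed

lemma nn_integral_near_err_le:
  fixes w :: "'a::euclidean_space \<Rightarrow> real" and c :: 'a and s p r R R\<^sub>1 :: real
  assumes p: "1 < p" and s: "s < 1" and r: "0 < r" "r < R\<^sub>1" "R\<^sub>1 < R"
    and wm: "w \<in> borel_measurable lebesgue"
  shows "(\<integral>\<^sup>+z. ennreal (near_err p (ball c R) (cutoff c r R\<^sub>1) w (fst z) (snd z)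
        / norm (fst z - snd z) powr (DIM('a) + s * p)) \<partial>lebesgue)
    \<le> ennreal (ball_kernel_const DIM('a) ((1 - s) * p) * (2 * R) powr ((1 - s) * p) / (R\<^sub>1 - r) powr p)
      * (\<integral>\<^sup>+x. ennreal (indicat_real (ball c R) x * w x powr p) \<partial>lebesgue)"
proof -
  let ?I = "indicat_real (ball c R)"
  let ?e = "cutoff c r R\<^sub>1"
  let ?g = "\<lambda>x y. ?I y * \<bar>?e x - ?e y\<bar> powr p / norm (x - y) powr (DIM('a) + s * p)"
  have im: "?I \<in> borel_measurable lebesgue"
    by (intro borel_measurable_indicator) auto
  have nm: "(\<lambda>y. norm (x - y)) \<in> borel_measurable lebesgue" for x :: 'a
    by (intro measurable_completion) simp
  note [measurable] = borel_measurable_lebesgue_fst[OF wm] borel_measurable_norm_diff_lebesgue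
    borel_measurable_lebesgue_fst[OF im] borel_measurable_lebesgue_snd[OF im]
    borel_measurable_lebesgue_fst[OF borel_measurable_cutoff] borel_measurable_lebesgue_snd[OF borel_measurable_cutoff]
    wm im nm
  have "(\<integral>\<^sup>+z. ennreal ((?I (fst z) * w (fst z) powr p) * ?g (fst z) (snd z)) \<partial>lebesgue)
      \<le> ennreal (ball_kernel_const DIM('a) ((1 - s) * p) * (2 * R) powr ((1 - s) * p) / (R\<^sub>1 - r) powr p)
      * (\<integral>\<^sup>+x. ennreal (?I x * w x powr p) \<partial>lebesgue)"
  proof (rule nn_integral_weighted_slices)
    show "(\<lambda>z. ennreal ((?I (fst z) * w (fst z) powr p) * ?g (fst z) (snd z))) \<in> borel_measurable lebesgue"
      by measurable
    show "(\<lambda>x. ?I x * w x powr p) \<in> borel_measurable lebesgue" by measurable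
    show "?g x \<in> borel_measurable lebesgue" for x by measurable
    show "(\<integral>\<^sup>+y. ennreal (?g x y) \<partial>lebesgue)
        \<le> ennreal (ball_kernel_const DIM('a) ((1 - s) * p) * (2 * R) powr ((1 - s) * p) / (R\<^sub>1 - r) powr p)"
      if "?I x * w x powr p \<noteq> 0" for x
      using that p s r by (intro cutoff_kernel_bound) (auto simp: indicator_def split: if_splits)
  qed auto
  then show ?thesis by (simp add: near_err_def)
qed

lemma nn_integral_far_err_le:
  fixes w :: "'a::euclidean_space \<Rightarrow> real" and c :: 'a and N q r R :: real
  assumes N: "0 \<le> N" and r: "0 < r" "r < R"
    and wm: "w \<in> borel_measurable lebesgue" and w: "\<And>x. 0 \<le> w x"
  shows "(\<integral>\<^sup>+z. ennreal (far_err p (ball c ((R + r) / 2)) (ball c R) w (fst z) (snd z)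
        / norm (fst z - snd z) powr N) \<partial>lebesgue)
    \<le> ennreal ((2 * R / (R - r)) powr N)
      * (\<integral>\<^sup>+y. ennreal (indicat_real (- ball c r) y * (w y powr (p - 1) / norm (y - c) powr N)) \<partial>lebesgue)
      * (\<integral>\<^sup>+x. ennreal (indicat_real (ball c R) x * w x) \<partial>lebesgue)"
    (is "_ \<le> ?c * _")
proof -
  let ?I = "indicat_real (ball c ((R + r) / 2))"
  let ?J = "indicat_real (- ball c R)"
  let ?g = "\<lambda>x y. ?J y * w y powr (p - 1) / norm (x - y) powr N"
  have im: "?I \<in> borel_measurable lebesgue"
    by (intro borel_measurable_indicator) auto
  have jm: "?J \<in> borel_measurable lebesgue"
    by (intro borel_measurable_indicator) auto
  have nm: "(\<lambda>y. norm (x - y)) \<in> borel_measurable lebesgue" for x :: 'a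
    by (intro measurable_completion) simp
  note [measurable] = borel_measurable_lebesgue_fst[OF wm] borel_measurable_lebesgue_snd[OF wm]
    borel_measurable_norm_diff_lebesgue
    borel_measurable_lebesgue_fst[OF im] borel_measurable_lebesgue_snd[OF jm] wm im jm nm
  have "(\<integral>\<^sup>+z. ennreal ((?I (fst z) * w (fst z)) * ?g (fst z) (snd z)) \<partial>lebesgue)
      \<le> ?c * (\<integral>\<^sup>+x. ennreal (?I x * w x) \<partial>lebesgue)"
  proof (rule nn_integral_weighted_slices)
    show "(\<lambda>z. ennreal ((?I (fst z) * w (fst z)) * ?g (fst z) (snd z))) \<in> borel_measurable lebesgue"
      by measurable
    show "(\<lambda>x. ?I x * w x) \<in> borel_measurable lebesgue" by measurable
    show "?g x \<in> borel_measurable lebesgue" for x by measurable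
    show "(\<integral>\<^sup>+y. ennreal (?g x y) \<partial>lebesgue) \<le> ?c" if "?I x * w x \<noteq> 0" for x
      using that N r wm w by (intro tail_kernel_bound) (auto simp: indicator_def split: if_splits)
  qed (use w in auto)
  also have "\<dots> \<le> ?c * (\<integral>\<^sup>+x. ennreal (indicat_real (ball c R) x * w x) \<partial>lebesgue)"
    using r w by (intro mult_left_mono nn_integral_mono ennreal_leI) (auto simp: indicator_def)
  finally show ?thesis by (simp add: far_err_def)
qed

section \<open>The Caccioppoli inequality\<close>

text \<open>
  The summands after \<open>1\<close> are the constants of the measure term, the \<open>L\<^sup>p\<close> term and the tail term. The bounds on
  \<open>K\<close> enter twice, from below for the gain and from above for the error, which explains \<open>\<Lambda>\<^sup>2\<close>.
\<close>

definition caccioppoli_const :: "real \<Rightarrow> real \<Rightarrow> real \<Rightarrow> real \<Rightarrow> real" where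
  "caccioppoli_const n s p \<Lambda> = 1 + 8 * \<Lambda> * p
     + 4 * \<Lambda>\<^sup>2 * p powr p * (ball_kernel_const n ((1 - s) * p) * 2 powr ((1 - s) * p + p))
     + 4 * \<Lambda>\<^sup>2 * p * 2 powr (n + s * p)"

lemma caccioppoli_const_ge_1:
  assumes "s < 1" "1 < p" "1 \<le> \<Lambda>" "0 \<le> n"
  shows "1 \<le> caccioppoli_const n s p \<Lambda>"
proof -
  have "0 < ball_kernel_const n ((1 - s) * p)"
    using assms by (intro ball_kernel_const_pos) auto
  then show ?thesis using assms unfolding caccioppoli_const_def by simp
qed

lemma weighted_sum_le:
  fixes a b c a' b' c' x y z :: real
  assumes "a \<le> a'" "b \<le> b'" "c \<le> c'" "0 \<le> x" "0 \<le> y" "0 \<le> z"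
  shows "a * x + b * y + c * z \<le> a' * x + b' * y + c' * z"
  using assms by (intro add_mono mult_right_mono) auto

text \<open>
  Only one competitor is needed for given balls and level: the one that replaces \<open>w\<close> by \<open>(1 - e\<^sup>p) w\<close>. The
  proof integrates \<open>truncation_pointwise\<close> against \<open>K\<close> over \<open>C_dom \<Omega>\<close>. All integrals are taken in
  \<open>[0, \<infinity>]\<close>; only the nonlocal energy of \<open>u\<close> is cancelled, and it is finite.
\<close>

lemma caccioppoli_of_energy_comparison:
  fixes u :: "real ^ 'n \<Rightarrow> real" and s p \<Lambda> r R k F\<^sub>0 :: real
  assumes s: "0 < s" "s < 1" and p: "1 < p" and \<Lambda>: "1 \<le> \<Lambda>"
    and \<Omega>: "open \<Omega>" "bounded \<Omega>"
    and Km: "(\<lambda>(x, y). K x y) \<in> borel_measurable lebesgue" and K0: "\<And>x y. 0 \<le> K x y"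
    and Kb: "AE (x, y) in lebesgue.
         1 / (\<Lambda> * norm (x - y) powr (real CARD('n) + s * p)) \<le> K x y
         \<and> K x y \<le> \<Lambda> / norm (x - y) powr (real CARD('n) + s * p)"
    and F: "caratheodory_on \<Omega> F" "0 \<le> F\<^sub>0"
      "AE x in lebesgue_on \<Omega>. \<forall>t. \<bar>F x t\<bar> \<le> F\<^sub>0"
    and ut: "u \<in> tail_space s p" and ue: "u \<in> energy_space s p \<Omega>"
    and r: "0 < r" "r < R" and B: "ball c R \<subseteq> \<Omega>"
    and le: "energy p K F \<Omega> u \<le> energy p K F \<Omega>
      (\<lambda>x. u x - sgn2_value \<sigma> * (cutoff c r ((R + r) / 2) x powr p * part \<sigma> (u x - k)))"
  shows "gagliardo_pow s p (ball c r) (\<lambda>x. part \<sigma> (u x - k))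
        + (\<integral>\<^sup>+x. ennreal (part \<sigma> (u x - k)) *
             (\<integral>\<^sup>+y. ennreal (part (flip \<sigma>) (u y - k) powr (p - 1)
                / norm (x - y) powr (real CARD('n) + s * p)) \<partial>lebesgue) \<partial>lebesgue_on (ball c r))
        \<le> ennreal (caccioppoli_const CARD('n) s p \<Lambda> *
            (F\<^sub>0 * measure lebesgue (level_set \<sigma> u k c R)
             + R powr ((1 - s) * p) / (R - r) powr p
                 * Lp_norm p (ball c R) (\<lambda>x. part \<sigma> (u x - k)) powr p
             + R powr (real CARD('n) + s * p) / (R - r) powr (real CARD('n) + s * p)
                 * Lp_norm 1 (ball c R) (\<lambda>x. part \<sigma> (u x - k))
                 * Tail s p (\<lambda>x. part \<sigma> (u x - k)) c r powr (p - 1)))"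
    (is "?LHS \<le> ennreal (_ * (F\<^sub>0 * ?A + ?P + ?T))")
proof -
  let ?N = "real CARD('n) + s * p"
  let ?b = "(1 - s) * p"
  let ?M = "lebesgue_on (C_dom \<Omega>)"
  define R1 where "R1 = (R + r) / 2"
  have R1: "r < R1" "R1 < R" using r by (auto simp: R1_def)
  have N: "0 \<le> ?N" using s p by simp
  define e where "e = cutoff c r R1"
  define w where "w x = part \<sigma> (u x - k)" for x
  define m where "m x = part (flip \<sigma>) (u x - k)" for x
  define v where "v x = u x - sgn2_value \<sigma> * (e x powr p * w x)" for x
  have w0: "0 \<le> w x" and m0: "0 \<le> m x" and wm0: "w x = 0 \<or> m x = 0" for x
    using part_flip_disjoint[of \<sigma> "u x - k"] by (auto simp: w_def m_def part_nonneg)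
  have u_eq: "u x = k + sgn2_value \<sigma> * (w x - m x)" for x
    using sgn2_value_part_diff[of \<sigma> "u x - k"] by (simp add: w_def m_def)
  have diff_u: "\<bar>u x - u y\<bar> = \<bar>(w x - m x) - (w y - m y)\<bar>" for x y
  proof -
    have "u x - u y = sgn2_value \<sigma> * ((w x - m x) - (w y - m y))"
      by (subst (1 2) u_eq) (simp add: algebra_simps)
    then show ?thesis by (simp add: abs_mult)
  qed
  have diff_v: "\<bar>v x - v y\<bar> = \<bar>((1 - e x powr p) * w x - m x) - ((1 - e y powr p) * w y - m y)\<bar>" for x y
  proof -
    have "v x - v y = sgn2_value \<sigma> * (((1 - e x powr p) * w x - m x) - ((1 - e y powr p) * w y - m y))"
      unfolding v_def by (subst (1 2) u_eq) (simp add: algebra_simps)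
    then show ?thesis by (simp add: abs_mult)
  qed

  have um: "u \<in> borel_measurable lebesgue" using ut by (simp add: tail_space_def)
  have uL: "in_Lp p \<Omega> u" using ue by (simp add: energy_space_def)
  have om: "\<Omega> \<in> sets lebesgue" using \<Omega> by auto
  have Cs: "C_dom \<Omega> \<in> sets lebesgue" by (rule C_dom_sets[OF \<Omega>(1)])
  have wm: "w \<in> borel_measurable lebesgue" and mm: "m \<in> borel_measurable lebesgue"
    using um unfolding w_def[abs_def] m_def[abs_def] by measurable
  have em: "e \<in> borel_measurable lebesgue" unfolding e_def by measurable
  have vm: "v \<in> borel_measurable lebesgue"
  proof -
    note [measurable] = um wm em
    show ?thesis unfolding v_def[abs_def] by measurable
  qed
  have im: "indicat_real (ball c \<rho>) \<in> borel_measurable lebesgue" for \<rho>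
    by (intro borel_measurable_indicator) auto
  have jm: "indicat_real (- ball c \<rho>) \<in> borel_measurable lebesgue" for \<rho>
    by (intro borel_measurable_indicator) auto
  have Km': "(\<lambda>z. K (fst z) (snd z)) \<in> borel_measurable lebesgue"
    using Km by (simp add: case_prod_unfold)
  note [measurable] = borel_measurable_lebesgue_fst[OF um] borel_measurable_lebesgue_snd[OF um]
    borel_measurable_lebesgue_fst[OF vm] borel_measurable_lebesgue_snd[OF vm]
    borel_measurable_lebesgue_fst[OF wm] borel_measurable_lebesgue_snd[OF wm]
    borel_measurable_lebesgue_fst[OF mm] borel_measurable_lebesgue_snd[OF mm]
    borel_measurable_lebesgue_fst[OF em] borel_measurable_lebesgue_snd[OF em]
    borel_measurable_lebesgue_fst[OF im] borel_measurable_lebesgue_snd[OF im]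
    borel_measurable_lebesgue_fst[OF jm] borel_measurable_lebesgue_snd[OF jm]
    borel_measurable_norm_diff_lebesgue Km'

  define gain where "gain z = local_gain p (ball c r) w m (fst z) (snd z)" for z
  define near where "near z = near_err p (ball c R) e w (fst z) (snd z)" for z
  define far where "far z = far_err p (ball c R1) (ball c R) w (fst z) (snd z)" for z
  define sw :: "(real ^ 'n) \<times> (real ^ 'n) \<Rightarrow> (real ^ 'n) \<times> (real ^ 'n)" where "sw z = (snd z, fst z)" for z
  define err where "err z = p powr p * (near z + near (sw z)) + p * (far z + far (sw z))" for z
  define Q where "Q z = norm (fst z - snd z :: real ^ 'n) powr ?N" for z
  have nn: "0 \<le> gain z" "0 \<le> near z" "0 \<le> far z" "0 \<le> Q z" for z
    using w0 by (auto simp: gain_def near_def far_def Q_def local_gain_def near_err_def far_err_def)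
  have err0: "0 \<le> err z" for z
    using nn p by (auto simp: err_def)
  have [measurable]: "gain \<in> borel_measurable lebesgue"
    unfolding gain_def[abs_def] local_gain_def by measurable
  have [measurable]: "near \<in> borel_measurable lebesgue" "(\<lambda>z. near (sw z)) \<in> borel_measurable lebesgue"
    unfolding near_def[abs_def] near_err_def sw_def fst_conv snd_conv by measurable
  have [measurable]: "far \<in> borel_measurable lebesgue" "(\<lambda>z. far (sw z)) \<in> borel_measurable lebesgue"
    unfolding far_def[abs_def] far_err_def sw_def fst_conv snd_conv by measurable
  have [measurable]: "err \<in> borel_measurable lebesgue"
    unfolding err_def[abs_def] by measurable
  have [measurable]: "Q \<in> borel_measurable lebesgue"
    unfolding Q_def[abs_def] by measurable
  have Q_sw: "Q (sw z) = Q z" for z by (simp add: Q_def sw_def norm_minus_commute)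

  have pointwise: "\<bar>v (fst z) - v (snd z)\<bar> powr p + gain z \<le> \<bar>u (fst z) - u (snd z)\<bar> powr p + err z" for z
    unfolding diff_u diff_v gain_def err_def near_def far_def sw_def fst_conv snd_conv
    using r R1 p w0 m0 wm0
    by (intro truncation_pointwise)
      (auto simp: e_def cutoff_bounds intro!: cutoff_eq_1 cutoff_eq_0)

  \<comment> \<open>The kernel bounds hold almost everywhere only, so they enter under the integral sign, not in \<open>pointwise\<close>.\<close>
  have Kbz: "AE z in lebesgue. 1 / (\<Lambda> * Q z) \<le> K (fst z) (snd z) \<and> K (fst z) (snd z) \<le> \<Lambda> / Q z"
    using Kb by (simp add: case_prod_unfold Q_def)

  define U where "U = (\<integral>\<^sup>+z. ennreal (\<bar>u (fst z) - u (snd z)\<bar> powr p * K (fst z) (snd z)) \<partial>?M)"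
  define V where "V = (\<integral>\<^sup>+z. ennreal (\<bar>v (fst z) - v (snd z)\<bar> powr p * K (fst z) (snd z)) \<partial>?M)"
  define G where "G = (\<integral>\<^sup>+z. ennreal (gain z * K (fst z) (snd z)) \<partial>?M)"
  define E where "E = (\<integral>\<^sup>+z. ennreal (err z * K (fst z) (snd z)) \<partial>?M)"

  \<comment> \<open>Finiteness of \<open>U\<close> is what allows its cancellation below.\<close>
  have U_fin: "U < \<infinity>"
  proof -
    have "U \<le> (\<integral>\<^sup>+z. ennreal \<Lambda> * ennreal (\<bar>u (fst z) - u (snd z)\<bar> powr p / Q z) \<partial>?M)"
      unfolding U_def
    proof (rule nn_integral_mono_AE)
      have "AE z in ?M. 1 / (\<Lambda> * Q z) \<le> K (fst z) (snd z) \<and> K (fst z) (snd z) \<le> \<Lambda> / Q z"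
        using Kbz Cs by (auto simp: AE_restrict_space_iff)
      then show "AE z in ?M. ennreal (\<bar>u (fst z) - u (snd z)\<bar> powr p * K (fst z) (snd z))
          \<le> ennreal \<Lambda> * ennreal (\<bar>u (fst z) - u (snd z)\<bar> powr p / Q z)"
      proof eventually_elim
        case (elim z)
        then have "\<bar>u (fst z) - u (snd z)\<bar> powr p * K (fst z) (snd z)
            \<le> \<bar>u (fst z) - u (snd z)\<bar> powr p * (\<Lambda> / Q z)"
          by (intro mult_left_mono) auto
        then show ?case
          using \<Lambda> by (simp add: ennreal_mult'[symmetric] ennreal_leI mult.commute)
      qed
    qed
    also have "\<dots> = ennreal \<Lambda> * (\<integral>\<^sup>+z. ennreal (\<bar>u (fst z) - u (snd z)\<bar> powr p / Q z) \<partial>?M)"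
      by (intro nn_integral_cmult measurable_restrict_space1) measurable
    also have "\<dots> < \<infinity>"
      using ue by (simp add: energy_space_def case_prod_unfold Q_def ennreal_mult_less_top)
    finally show ?thesis .
  qed

  \<comment> \<open>The competitor differs from \<open>u\<close> only on the level set, which bounds the change of the potential.\<close>
  define A where "A = level_set \<sigma> u k c R"
  have A_sets: "A \<in> sets lebesgue"
  proof -
    have "A = ball c R \<inter> {x \<in> space lebesgue. w x \<noteq> 0}"
      by (auto simp: A_def level_set_eq w_def)
    moreover have "{x \<in> space lebesgue. w x \<noteq> 0} \<in> sets lebesgue"
      using wm by measurable
    moreover have "ball c R \<in> sets lebesgue" by simp
    ultimately show ?thesis by (simp only: sets.Int)
  qed
  have "(\<integral>x. F x (v x) \<partial>lebesgue_on \<Omega>) - (\<integral>x. F x (u x) \<partial>lebesgue_on \<Omega>) \<le> 2 * F\<^sub>0 * measure lebesgue A"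
  proof (rule potential_difference_le[OF \<Omega> F(1,3) um vm A_sets])
    show "A \<subseteq> \<Omega>" using B by (auto simp: A_def level_set_eq)
    show "v x = u x" if "x \<notin> A" for x
    proof -
      have "w x = 0 \<or> e x = 0"
        using that R1 by (auto simp: A_def level_set_eq w_def e_def intro!: cutoff_eq_0)
      then show ?thesis using p by (auto simp: v_def)
    qed
  qed
  then have UV: "U \<le> V + ennreal (2 * p * (2 * F\<^sub>0 * measure lebesgue A))"
    using energy_le_imp_nonlocal_le[of p K F \<Omega> u v "2 * F\<^sub>0 * measure lebesgue A"] le p U_fin F(2)
    by (simp add: U_def V_def case_prod_unfold v_def[abs_def] e_def w_def R1_def)

  have VG: "V + G \<le> U + E"
  proof -
    have "V + G = (\<integral>\<^sup>+z. ennreal (\<bar>v (fst z) - v (snd z)\<bar> powr p * K (fst z) (snd z))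
        + ennreal (gain z * K (fst z) (snd z)) \<partial>?M)"
      unfolding V_def G_def
      by (intro nn_integral_add[symmetric] measurable_restrict_space1) measurable
    also have "\<dots> \<le> (\<integral>\<^sup>+z. ennreal (\<bar>u (fst z) - u (snd z)\<bar> powr p * K (fst z) (snd z))
        + ennreal (err z * K (fst z) (snd z)) \<partial>?M)"
    proof (rule nn_integral_mono)
      fix z
      have "(\<bar>v (fst z) - v (snd z)\<bar> powr p + gain z) * K (fst z) (snd z)
          \<le> (\<bar>u (fst z) - u (snd z)\<bar> powr p + err z) * K (fst z) (snd z)"
        by (intro mult_right_mono pointwise K0)
      then show "ennreal (\<bar>v (fst z) - v (snd z)\<bar> powr p * K (fst z) (snd z)) + ennreal (gain z * K (fst z) (snd z))
          \<le> ennreal (\<bar>u (fst z) - u (snd z)\<bar> powr p * K (fst z) (snd z)) + ennreal (err z * K (fst z) (snd z))"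
        using nn(1)[of z] err0[of z] K0
        by (simp add: ennreal_plus[symmetric] distrib_right ennreal_leI del: ennreal_plus)
    qed
    also have "\<dots> = U + E"
      unfolding U_def E_def
      by (intro nn_integral_add measurable_restrict_space1) measurable
    finally show ?thesis .
  qed
  have "U + G \<le> V + ennreal (2 * p * (2 * F\<^sub>0 * measure lebesgue A)) + G"
    by (intro add_right_mono UV)
  also have "\<dots> = (V + G) + ennreal (4 * p * F\<^sub>0 * measure lebesgue A)"
    by (simp add: ac_simps)
  also have "\<dots> \<le> (U + E) + ennreal (4 * p * F\<^sub>0 * measure lebesgue A)"
    by (intro add_right_mono VG)
  finally have "U + G \<le> U + (E + ennreal (4 * p * F\<^sub>0 * measure lebesgue A))"
    by (simp only: add.assoc)
  then have GE: "G \<le> E + ennreal (4 * p * F\<^sub>0 * measure lebesgue A)"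
    using U_fin by (auto simp: ennreal_add_left_cancel_le)

  have "?LHS = (\<integral>\<^sup>+z. ennreal (2 * (gain z / Q z)) \<partial>lebesgue)"
    using nn_integral_local_gain[OF um, of s p c r \<sigma> k]
    by (simp add: gain_def Q_def w_def[abs_def] m_def[abs_def])
  also have "\<dots> \<le> (\<integral>\<^sup>+z. ennreal (2 * \<Lambda>) * (ennreal (gain z * K (fst z) (snd z)) * indicator (C_dom \<Omega>) z) \<partial>lebesgue)"
  proof (rule nn_integral_mono_AE)
    show "AE z in lebesgue. ennreal (2 * (gain z / Q z))
        \<le> ennreal (2 * \<Lambda>) * (ennreal (gain z * K (fst z) (snd z)) * indicator (C_dom \<Omega>) z)"
      using Kbz
    proof eventually_elim
      case (elim z)
      show ?case
      proof (cases "gain z = 0")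
        case False
        \<comment> \<open>The gain lives on pairs with first point in the small ball, hence inside \<open>C_dom \<Omega>\<close>.\<close>
        have z: "z \<in> C_dom \<Omega>"
        proof -
          have "fst z \<in> ball c r"
            using False by (rule contrapos_np) (simp add: gain_def local_gain_def)
          then have "fst z \<in> \<Omega>" using B r by auto
          then show ?thesis by (auto simp: C_dom_def mem_Times_iff)
        qed
        have "gain z * (1 / (\<Lambda> * Q z)) \<le> gain z * K (fst z) (snd z)"
          using elim nn by (intro mult_left_mono) auto
        then have "2 * \<Lambda> * (gain z * (1 / (\<Lambda> * Q z))) \<le> 2 * \<Lambda> * (gain z * K (fst z) (snd z))"
          by (rule mult_left_mono) (use \<Lambda> in simp)
        then have "2 * (gain z / Q z) \<le> 2 * \<Lambda> * (gain z * K (fst z) (snd z))"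
          using \<Lambda> by simp
        then show ?thesis
          using z \<Lambda> by (simp add: ennreal_mult'[symmetric] ennreal_leI)
      qed simp
    qed
  qed
  also have "\<dots> = ennreal (2 * \<Lambda>) * G"
  proof -
    have [measurable]: "C_dom \<Omega> \<in> sets lebesgue" by (rule Cs)
    show ?thesis
      unfolding G_def using Cs by (simp add: nn_integral_cmult nn_integral_restrict_space)
  qed
  finally have LG: "?LHS \<le> ennreal (2 * \<Lambda>) * G" .

  define Ip where "Ip = Lp_norm p (ball c R) w powr p"
  define I1 where "I1 = Lp_norm 1 (ball c R) w"
  define T where "T = Tail s p w c r powr (p - 1)"
  have nonneg: "0 \<le> Ip" "0 \<le> I1" "0 \<le> T" by (auto simp: Ip_def I1_def T_def Lp_norm_def)
  have Ip: "ennreal Ip = (\<integral>\<^sup>+x. ennreal (indicat_real (ball c R) x * w x powr p) \<partial>lebesgue)"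
    using Lp_norm_powr_eq_nn_integral[OF um uL B om, of p \<sigma> k] p
    by (simp add: Ip_def w_def[abs_def])
  have I1: "ennreal I1 = (\<integral>\<^sup>+x. ennreal (indicat_real (ball c R) x * w x) \<partial>lebesgue)"
    using Lp_norm_powr_eq_nn_integral[OF um uL B om, of 1 \<sigma> k] p nonneg w0
    by (simp add: I1_def w_def[abs_def])
  have T: "ennreal T = (\<integral>\<^sup>+y. ennreal (indicat_real (- ball c r) y * (w y powr (p - 1) / norm (y - c) powr ?N)) \<partial>lebesgue)"
    using Tail_powr_eq_nn_integral[OF s(1) p ut r(1), of \<sigma> k c] by (simp add: T_def w_def[abs_def])

  define cn where "cn = ball_kernel_const CARD('n) ?b * 2 powr (?b + p) * (R powr ?b / (R - r) powr p)"
  define cf where "cf = 2 powr ?N * (R powr ?N / (R - r) powr ?N)"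
  have bk: "0 < ball_kernel_const CARD('n) ?b"
    using s p by (intro ball_kernel_const_pos) auto
  have c0: "0 \<le> cn" "0 \<le> cf" using bk by (auto simp: cn_def cf_def)
  have near_le: "(\<integral>\<^sup>+z. ennreal (near z / Q z) \<partial>lebesgue) \<le> ennreal (cn * Ip)"
  proof -
    have "ball_kernel_const CARD('n) ?b * (2 * R) powr ?b / (R1 - r) powr p = cn"
    proof -
      have "R1 - r = (R - r) / 2" by (simp add: R1_def field_simps)
      then have "(R1 - r) powr p = (R - r) powr p / 2 powr p"
        using r by (simp only: powr_divide)
      then show ?thesis
        using r by (simp add: cn_def powr_mult powr_add)
    qed
    then show ?thesis
      using nn_integral_near_err_le[OF p s(2) r(1) R1 wm, of c] c0 nonneg
      by (simp add: near_def Q_def e_def Ip[symmetric] ennreal_mult'[symmetric])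
  qed
  have far_le: "(\<integral>\<^sup>+z. ennreal (far z / Q z) \<partial>lebesgue) \<le> ennreal (cf * (I1 * T))"
  proof -
    have "(2 * R / (R - r)) powr ?N = cf"
      using r by (simp add: cf_def powr_mult powr_divide)
    then have "(\<integral>\<^sup>+z. ennreal (far z / Q z) \<partial>lebesgue) \<le> ennreal cf * ennreal T * ennreal I1"
      using nn_integral_far_err_le[OF N r wm w0, of p c]
      by (simp only: far_def Q_def R1_def I1 T)
    also have "\<dots> = ennreal (cf * (I1 * T))"
      using c0 nonneg by (simp add: ennreal_mult[symmetric] mult_ac)
    finally show ?thesis .
  qed
  \<comment> \<open>The kernel is symmetric, so the error terms with interchanged points have the same integrals.\<close>
  have swap: "(\<integral>\<^sup>+z. ennreal (f (sw z) / Q z) \<partial>lebesgue) = (\<integral>\<^sup>+z. ennreal (f z / Q z) \<partial>lebesgue)"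
    if [measurable]: "f \<in> borel_measurable lebesgue" "(\<lambda>z. f (sw z)) \<in> borel_measurable lebesgue" for f
  proof -
    have 1: "(\<lambda>z. ennreal (f z / Q z)) \<in> borel_measurable lebesgue" by measurable
    have "(\<lambda>z. ennreal (f (sw z) / Q z)) \<in> borel_measurable lebesgue" by measurable
    then have 2: "(\<lambda>z. ennreal (f (snd z, fst z) / Q (snd z, fst z))) \<in> borel_measurable lebesgue"
      using Q_sw by (simp add: sw_def)
    show ?thesis
      using nn_integral_lebesgue_swap[OF 1 2] Q_sw by (simp add: sw_def)
  qed
  define a1 where "a1 = 2 * \<Lambda> * p powr p * cn * Ip"
  define a2 where "a2 = 2 * \<Lambda> * p * cf * (I1 * T)"
  have a0: "0 \<le> a1" "0 \<le> a2" "0 \<le> 4 * p * F\<^sub>0 * measure lebesgue A"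
    using c0 nonneg \<Lambda> p F(2) by (auto simp: a1_def a2_def)
  have "E \<le> (\<integral>\<^sup>+z. ennreal (\<Lambda> * p powr p) * (ennreal (near z / Q z) + ennreal (near (sw z) / Q z))
      + ennreal (\<Lambda> * p) * (ennreal (far z / Q z) + ennreal (far (sw z) / Q z)) \<partial>lebesgue)"
  proof -
    have "E = (\<integral>\<^sup>+z. ennreal (err z * K (fst z) (snd z)) * indicator (C_dom \<Omega>) z \<partial>lebesgue)"
      unfolding E_def using Cs by (simp add: nn_integral_restrict_space)
    also have "\<dots> \<le> (\<integral>\<^sup>+z. ennreal (\<Lambda> * p powr p) * (ennreal (near z / Q z) + ennreal (near (sw z) / Q z))
      + ennreal (\<Lambda> * p) * (ennreal (far z / Q z) + ennreal (far (sw z) / Q z)) \<partial>lebesgue)"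
    proof (rule nn_integral_mono_AE)
      show "AE z in lebesgue. ennreal (err z * K (fst z) (snd z)) * indicator (C_dom \<Omega>) z
          \<le> ennreal (\<Lambda> * p powr p) * (ennreal (near z / Q z) + ennreal (near (sw z) / Q z))
            + ennreal (\<Lambda> * p) * (ennreal (far z / Q z) + ennreal (far (sw z) / Q z))"
        using Kbz
      proof eventually_elim
        case (elim z)
        have "ennreal (err z * K (fst z) (snd z)) * indicator (C_dom \<Omega>) z \<le> ennreal (err z * K (fst z) (snd z))"
          by (simp add: indicator_def)
        also have "\<dots> \<le> ennreal (err z * (\<Lambda> / Q z))"
          using elim err0 by (intro ennreal_leI mult_left_mono) auto
        also have "err z * (\<Lambda> / Q z) = \<Lambda> * p powr p * (near z / Q z + near (sw z) / Q z)
            + \<Lambda> * p * (far z / Q z + far (sw z) / Q z)"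
          by (simp add: err_def algebra_simps add_divide_distrib)
        also have "ennreal \<dots> = ennreal (\<Lambda> * p powr p) * (ennreal (near z / Q z) + ennreal (near (sw z) / Q z))
            + ennreal (\<Lambda> * p) * (ennreal (far z / Q z) + ennreal (far (sw z) / Q z))"
          using nn \<Lambda> p
          by (subst ennreal_plus) (auto simp: ennreal_mult' intro!: mult_nonneg_nonneg add_nonneg_nonneg)
        finally show ?case .
      qed
    qed
    finally show ?thesis .
  qed
  also have "\<dots> = ennreal (\<Lambda> * p powr p) * ((\<integral>\<^sup>+z. ennreal (near z / Q z) \<partial>lebesgue) + (\<integral>\<^sup>+z. ennreal (near (sw z) / Q z) \<partial>lebesgue))
      + ennreal (\<Lambda> * p) * ((\<integral>\<^sup>+z. ennreal (far z / Q z) \<partial>lebesgue) + (\<integral>\<^sup>+z. ennreal (far (sw z) / Q z) \<partial>lebesgue))"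
    by (simp add: nn_integral_add nn_integral_cmult)
  also have "\<dots> \<le> ennreal (\<Lambda> * p powr p) * (ennreal (cn * Ip) + ennreal (cn * Ip))
      + ennreal (\<Lambda> * p) * (ennreal (cf * (I1 * T)) + ennreal (cf * (I1 * T)))"
    using near_le far_le by (intro add_mono mult_left_mono) (auto simp: swap)
  also have "\<dots> = ennreal (a1 + a2)"
  proof -
    have twice: "ennreal a * (ennreal b + ennreal b) = ennreal (a * (b + b))"
      if "0 \<le> a" "0 \<le> b" for a b
      unfolding ennreal_mult'[OF that(1)] ennreal_plus[OF that(2) that(2)] ..
    have "0 \<le> cn * Ip" "0 \<le> cf * (I1 * T)" using c0 nonneg by auto
    then have "ennreal (\<Lambda> * p powr p) * (ennreal (cn * Ip) + ennreal (cn * Ip)) = ennreal a1"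
      "ennreal (\<Lambda> * p) * (ennreal (cf * (I1 * T)) + ennreal (cf * (I1 * T))) = ennreal a2"
      using \<Lambda> p by (simp_all add: twice a1_def a2_def mult_ac)
    then show ?thesis
      using a0 by (simp only: ennreal_plus)
  qed
  finally have E_le: "E \<le> ennreal (a1 + a2)" .

  have "?LHS \<le> ennreal (2 * \<Lambda>) * (ennreal (a1 + a2) + ennreal (4 * p * F\<^sub>0 * measure lebesgue A))"
    by (intro order_trans[OF LG] mult_left_mono order_trans[OF GE] add_right_mono E_le) auto
  also have "\<dots> = ennreal (2 * \<Lambda> * (a1 + a2 + 4 * p * F\<^sub>0 * measure lebesgue A))"
    using a0 \<Lambda> by (simp add: ennreal_plus[symmetric] ennreal_mult'[symmetric] del: ennreal_plus)
  also have "\<dots> \<le> ennreal (caccioppoli_const CARD('n) s p \<Lambda> * (F\<^sub>0 * ?A + ?P + ?T))"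
  proof (rule ennreal_leI)
    define Cn where "Cn = ball_kernel_const CARD('n) ?b * 2 powr (?b + p)"
    define H where "H = caccioppoli_const CARD('n) s p \<Lambda>"
    define X where "X = F\<^sub>0 * measure lebesgue A"
    define Y where "Y = R powr ?b / (R - r) powr p * Ip"
    define Z where "Z = R powr ?N / (R - r) powr ?N * I1 * T"
    have XYZ: "0 \<le> X" "0 \<le> Y" "0 \<le> Z" using F(2) nonneg by (auto simp: X_def Y_def Z_def)
    have h: "0 \<le> 8 * \<Lambda> * p" "0 \<le> 4 * \<Lambda>\<^sup>2 * p powr p * Cn" "0 \<le> 4 * \<Lambda>\<^sup>2 * p * 2 powr ?N"
      using \<Lambda> p bk by (auto simp: Cn_def)
    have H: "H = 1 + 8 * \<Lambda> * p + 4 * \<Lambda>\<^sup>2 * p powr p * Cn + 4 * \<Lambda>\<^sup>2 * p * 2 powr ?N"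
      by (simp add: H_def caccioppoli_const_def Cn_def)
    have "2 * \<Lambda> * (a1 + a2 + 4 * p * F\<^sub>0 * measure lebesgue A)
        = (8 * \<Lambda> * p) * X + (4 * \<Lambda>\<^sup>2 * p powr p * Cn) * Y + (4 * \<Lambda>\<^sup>2 * p * 2 powr ?N) * Z"
      by (simp add: a1_def a2_def cn_def cf_def Cn_def X_def Y_def Z_def power2_eq_square algebra_simps)
    also have "\<dots> \<le> H * X + H * Y + H * Z"
      using h XYZ by (intro weighted_sum_le) (auto simp: H)
    also have "\<dots> = H * (X + Y + Z)" by (simp add: algebra_simps)
    finally show "2 * \<Lambda> * (a1 + a2 + 4 * p * F\<^sub>0 * measure lebesgue A)
        \<le> caccioppoli_const CARD('n) s p \<Lambda> * (F\<^sub>0 * ?A + ?P + ?T)"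
      by (simp add: H_def X_def Y_def Z_def A_def Ip_def I1_def T_def w_def[abs_def])
  qed
  finally show ?thesis .
qed

section \<open>Minimizers and De Giorgi classes\<close>

lemma supported_inside_cutoff:
  fixes \<Omega> :: "(real ^ 'n) set"
  assumes "r < R'" "R' < R" "ball c R \<subseteq> \<Omega>" "0 < p"
  shows "supported_inside (\<lambda>x. a * (cutoff c r R' x powr p * g x)) \<Omega>"
proof -
  have "{x. a * (cutoff c r R' x powr p * g x) \<noteq> 0} \<subseteq> cball c R'"
    using cutoff_eq_0[OF assms(1), of _ c] assms(4) by (auto simp: not_less less_imp_le intro: ccontr)
  then have "closure {x. a * (cutoff c r R' x powr p * g x) \<noteq> 0} \<subseteq> cball c R'"
    by (rule closure_minimal) auto
  also have "\<dots> \<subseteq> ball c R" using assms by auto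
  finally show ?thesis using assms(3) by (auto simp: supported_inside_def)
qed

text \<open>
  Subminimality for the upper sign and superminimality for the lower sign, so that both are treated
  at once.
\<close>

definition one_sided_minimizer ::
    "sgn2 \<Rightarrow> real \<Rightarrow> (real ^ 'n \<Rightarrow> real ^ 'n \<Rightarrow> real) \<Rightarrow> (real ^ 'n \<Rightarrow> real \<Rightarrow> real) \<Rightarrow>
     (real ^ 'n) set \<Rightarrow> (real ^ 'n \<Rightarrow> real) \<Rightarrow> bool" where
  "one_sided_minimizer \<sigma> p K F \<Omega> u \<longleftrightarrow>
     (\<forall>\<phi>. \<phi> \<in> borel_measurable lebesgue \<and> supported_inside \<phi> \<Omega> \<and> (\<forall>x. sgn2_value \<sigma> * \<phi> x \<le> 0)
        \<longrightarrow> energy p K F \<Omega> u \<le> energy p K F \<Omega> (\<lambda>x. u x + \<phi> x))"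

lemma one_sided_minimizer_DG_signed:
  fixes u :: "real ^ 'n \<Rightarrow> real" and s p \<Lambda> F\<^sub>0 :: real
  assumes s: "0 < s" "s < 1" and p: "1 < p" and \<Lambda>: "1 \<le> \<Lambda>"
    and \<Omega>: "open \<Omega>" "bounded \<Omega>"
    and K: "(\<lambda>(x, y). K x y) \<in> borel_measurable lebesgue" "\<And>x y. 0 \<le> K x y"
      "AE (x, y) in lebesgue.
         1 / (\<Lambda> * norm (x - y) powr (real CARD('n) + s * p)) \<le> K x y
         \<and> K x y \<le> \<Lambda> / norm (x - y) powr (real CARD('n) + s * p)"
    and F: "caratheodory_on \<Omega> F" "0 \<le> F\<^sub>0"
      "AE x in lebesgue_on \<Omega>. \<forall>t. \<bar>F x t\<bar> \<le> F\<^sub>0"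
    and u: "u \<in> tail_space s p" "u \<in> energy_space s p \<Omega>"
    and min: "one_sided_minimizer \<sigma> p K F \<Omega> u"
  shows "u \<in> DG_signed \<sigma> s p \<Omega> (F\<^sub>0 powr (1 / p)) (caccioppoli_const CARD('n) s p \<Lambda>) 0"
proof -
  have um [measurable]: "u \<in> borel_measurable lebesgue" using u by (simp add: tail_space_def)
  have d: "(F\<^sub>0 powr (1 / p)) powr p = F\<^sub>0" using F(2) p by (simp add: powr_powr)
  show ?thesis
    unfolding DG_signed_def mem_Collect_eq
  proof (intro conjI allI impI, fact u(1), rule frac_sobolev_of_energy_space[OF \<Omega>(1) u(2)], elim conjE)
    fix c r R k
    assume r: "c \<in> \<Omega>" "0 < r" "r < R" "R < infdist c (frontier \<Omega>)"
    have B: "ball c R \<subseteq> \<Omega>" by (rule ball_subset_of_infdist_frontier[OF r(1,4)])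
    define \<phi> where "\<phi> x = - sgn2_value \<sigma> * (cutoff c r ((R + r) / 2) x powr p * part \<sigma> (u x - k))" for x
    have "\<phi> \<in> borel_measurable lebesgue" unfolding \<phi>_def[abs_def] by measurable
    moreover have "supported_inside \<phi> \<Omega>"
      unfolding \<phi>_def[abs_def] using r p B by (intro supported_inside_cutoff[where R = R]) auto
    moreover have "sgn2_value \<sigma> * \<phi> x \<le> 0" for x
      by (simp add: \<phi>_def sgn2_value_def part_nonneg)
    ultimately have "energy p K F \<Omega> u \<le> energy p K F \<Omega> (\<lambda>x. u x + \<phi> x)"
      using min by (simp add: one_sided_minimizer_def)
    then have le: "energy p K F \<Omega> u \<le> energy p K F \<Omega>
        (\<lambda>x. u x - sgn2_value \<sigma> * (cutoff c r ((R + r) / 2) x powr p * part \<sigma> (u x - k)))"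
      by (simp add: \<phi>_def)
    have R0: "R powr 0 = 1" using r by simp
    show "gagliardo_pow s p (ball c r) (\<lambda>x. part \<sigma> (u x - k))
        + (\<integral>\<^sup>+x. ennreal (part \<sigma> (u x - k)) *
             (\<integral>\<^sup>+y. ennreal (part (flip \<sigma>) (u y - k) powr (p - 1)
                / norm (x - y) powr (real CARD('n) + s * p)) \<partial>lebesgue) \<partial>lebesgue_on (ball c r))
        \<le> ennreal (caccioppoli_const CARD('n) s p \<Lambda> *
            (R powr 0 * (F\<^sub>0 powr (1 / p)) powr p * measure lebesgue (level_set \<sigma> u k c R)
             + R powr ((1 - s) * p) / (R - r) powr p
                 * Lp_norm p (ball c R) (\<lambda>x. part \<sigma> (u x - k)) powr p
             + R powr (real CARD('n) + s * p) / (R - r) powr (real CARD('n) + s * p)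
                 * Lp_norm 1 (ball c R) (\<lambda>x. part \<sigma> (u x - k))
                 * Tail s p (\<lambda>x. part \<sigma> (u x - k)) c r powr (p - 1)))"
      unfolding d R0 mult_1_left
      by (rule caccioppoli_of_energy_comparison[OF s p \<Lambda> \<Omega> K F u r(2,3) B le])
  qed
qed

theorem theorem3p2:
  fixes s p \<Lambda> :: real
  assumes "0 < s" "s < 1" "1 < p" "1 \<le> \<Lambda>"
  shows "\<exists>H\<ge>1. \<forall>(F\<^sub>0::real) (\<Omega>::(real ^ 'n) set) K F u.
      0 \<le> F\<^sub>0
    \<and> open \<Omega> \<and> bounded \<Omega>
    \<and> (\<lambda>(x, y). K x y) \<in> borel_measurable lebesgue
    \<and> (\<forall>x y. 0 \<le> K x y) \<and> (\<forall>x y. K x y = K y x)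
    \<and> (AE (x, y) in lebesgue.
         1 / (\<Lambda> * norm (x - y) powr (real CARD('n) + s * p)) \<le> K x y
         \<and> K x y \<le> \<Lambda> / norm (x - y) powr (real CARD('n) + s * p))
    \<and> caratheodory_on \<Omega> F
    \<and> (AE x in lebesgue_on \<Omega>. \<forall>t. \<bar>F x t\<bar> \<le> F\<^sub>0)
    \<and> u \<in> tail_space s p \<and> u \<in> energy_space s p \<Omega>
    \<longrightarrow> (superminimizer s p K F \<Omega> u \<longrightarrow> u \<in> DG_minus s p \<Omega> (F\<^sub>0 powr (1 / p)) H 0)
      \<and> (subminimizer s p K F \<Omega> u \<longrightarrow> u \<in> DG_plus s p \<Omega> (F\<^sub>0 powr (1 / p)) H 0)
      \<and> (minimizer s p K F \<Omega> u \<longrightarrow> u \<in> DG s p \<Omega> (F\<^sub>0 powr (1 / p)) H 0)"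
proof (rule exI[of _ "caccioppoli_const CARD('n) s p \<Lambda>"], rule conjI)
  show "1 \<le> caccioppoli_const CARD('n) s p \<Lambda>"
    using assms by (intro caccioppoli_const_ge_1) auto
  have super: "one_sided_minimizer Minus p K F \<Omega> u" if "superminimizer s p K F \<Omega> u"
    for K F and \<Omega> :: "(real ^ 'n) set" and u
    using that by (simp add: superminimizer_def one_sided_minimizer_def sgn2_value_def)
  have sub: "one_sided_minimizer Plus p K F \<Omega> u" if "subminimizer s p K F \<Omega> u"
    for K F and \<Omega> :: "(real ^ 'n) set" and u
    using that by (simp add: subminimizer_def one_sided_minimizer_def sgn2_value_def)
  have min: "one_sided_minimizer \<sigma> p K F \<Omega> u" if "minimizer s p K F \<Omega> u"
    for \<sigma> K F and \<Omega> :: "(real ^ 'n) set" and u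
    using that by (simp add: minimizer_def one_sided_minimizer_def)
  show "\<forall>(F\<^sub>0::real) (\<Omega>::(real ^ 'n) set) K F u.
      0 \<le> F\<^sub>0
    \<and> open \<Omega> \<and> bounded \<Omega>
    \<and> (\<lambda>(x, y). K x y) \<in> borel_measurable lebesgue
    \<and> (\<forall>x y. 0 \<le> K x y) \<and> (\<forall>x y. K x y = K y x)
    \<and> (AE (x, y) in lebesgue.
         1 / (\<Lambda> * norm (x - y) powr (real CARD('n) + s * p)) \<le> K x y
         \<and> K x y \<le> \<Lambda> / norm (x - y) powr (real CARD('n) + s * p))
    \<and> caratheodory_on \<Omega> F
    \<and> (AE x in lebesgue_on \<Omega>. \<forall>t. \<bar>F x t\<bar> \<le> F\<^sub>0)
    \<and> u \<in> tail_space s p \<and> u \<in> energy_space s p \<Omega>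
    \<longrightarrow> (superminimizer s p K F \<Omega> u
          \<longrightarrow> u \<in> DG_minus s p \<Omega> (F\<^sub>0 powr (1 / p)) (caccioppoli_const CARD('n) s p \<Lambda>) 0)
      \<and> (subminimizer s p K F \<Omega> u
          \<longrightarrow> u \<in> DG_plus s p \<Omega> (F\<^sub>0 powr (1 / p)) (caccioppoli_const CARD('n) s p \<Lambda>) 0)
      \<and> (minimizer s p K F \<Omega> u
          \<longrightarrow> u \<in> DG s p \<Omega> (F\<^sub>0 powr (1 / p)) (caccioppoli_const CARD('n) s p \<Lambda>) 0)"
    unfolding DG_def Int_iff
    by (intro allI impI conjI; elim conjE; rule one_sided_minimizer_DG_signed[OF assms])
      (assumption | blast | erule super | erule sub | erule min)+
qed

end
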